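(* Let $\mu\in(0,1/2]$ and $c<c_J$. Then the universal cover of each connected component of the regularized energy hypersurface of the Euler problem at energy $c$ is dynamically convex, i.e. every periodic Reeb orbit on it has Conley–Zehnder index at least $3$.
   Context: Fix $\mu\in(0,1/2]$, $E=(-1/2,0)$, $M=(1/2,0)$, $H(q,p)=\tfrac12|p|^2-\frac{1-\mu}{|q-E|}-\frac{\mu}{|q-M|}$ on $(\mathbb R^2\setminus\{E,M\})\times\mathbb R^2$ with $\omega=\sum dp_j\wedge dq_j$, and $c_J=-1-2\sqrt{\mu(1-\mu)}$. For $c<c_J$, $H^{-1}(c)$ has two components (one near $E$, one near $M$); each, after regularization of two-body collisions, is a closed 3-manifold diffeomorphic to $\mathbb{RP}^3$ of restricted contact type (transverse Liouville vector fields $(q-E)\partial_q$ resp. $(q-M)\partial_q$, extended over the regularization), hence carries a contact form whose Reeb flow is a reparametrization of the Hamiltonian flow. Its universal cover is $S^3$ with the pulled-back contact form (realized, e.g., as a component of $K_c^{-1}(0)$, $K_c=2p_\lambda^2-2\cosh\lambda-c\cosh^2\lambda+2p_\nu^2+2(1-2\mu)\cos\nu+c\cos^2\nu$, in doubly covered elliptic coordinates $q_1=\frac12\cosh\lambda\cos\nu$, $q_2=\frac12\sinh\lambda\sin\nu$). The Conley–Zehnder index of a periodic Reeb orbit is the Hofer–Wysocki–Zehnder index computed with a trivialization of the contact structure over a spanning disk. *)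

theory Defs
  imports "HOL-Analysis.Analysis"
begin

text \<open>Phase space of the regularized Euler problem, lifted to R^4:
  a point is ((lambda, nu), (p_lambda, p_nu)); first component = position q, second = momentum p.\<close>
type_synonym ph = "(real \<times> real) \<times> (real \<times> real)"

text \<open>The regularized Hamiltonian K_c (doubly covered elliptic coordinates).\<close>
definition Kc :: "real \<Rightarrow> real \<Rightarrow> ph \<Rightarrow> real" where
  "Kc \<mu> c z = (case z of ((l, n), (pl, pn)) \<Rightarrow>
      2 * pl\<^sup>2 - 2 * cosh l - c * (cosh l)\<^sup>2 + 2 * pn\<^sup>2 + 2 * (1 - 2 * \<mu>) * cos n + c * (cos n)\<^sup>2)"

definition cJ :: "real \<Rightarrow> real" where
  "cJ \<mu> = -1 - 2 * sqrt (\<mu> * (1 - \<mu>))"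

definition symp :: "ph \<Rightarrow> ph \<Rightarrow> real" where
  "symp u v = snd u \<bullet> fst v - fst u \<bullet> snd v"

definition ham_vf :: "(ph \<Rightarrow> real) \<Rightarrow> ph \<Rightarrow> ph" where
  "ham_vf H z = (THE X. \<forall>w. symp X w = - frechet_derivative H (at z) w)"

text \<open>Transverse (symplectic) plane at y: tangent vectors to the level set that are
  Euclidean-orthogonal to the Hamiltonian vector field; canonically isomorphic to
  T Sigma / R X, hence to the contact structure.\<close>
definition transv :: "(ph \<Rightarrow> real) \<Rightarrow> ph \<Rightarrow> ph set" where
  "transv H y = {v. frechet_derivative H (at y) v = 0 \<and> v \<bullet> ham_vf H y = 0}"

definition periodic_orbit :: "(ph \<Rightarrow> real) \<Rightarrow> ph set \<Rightarrow> (real \<Rightarrow> ph) \<Rightarrow> real \<Rightarrow> bool" where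
  "periodic_orbit H S x T \<longleftrightarrow> 0 < T \<and> (\<forall>t. x t \<in> S) \<and> (\<forall>t. x (t + T) = x t) \<and>
     (\<forall>t. (x has_vector_derivative ham_vf H (x t)) (at t))"

definition linearized_flow :: "(ph \<Rightarrow> real) \<Rightarrow> (real \<Rightarrow> ph) \<Rightarrow> (real \<Rightarrow> ph \<Rightarrow> ph) \<Rightarrow> bool" where
  "linearized_flow H x \<Phi> \<longleftrightarrow> (\<forall>v. \<Phi> 0 v = v) \<and>
     (\<forall>v t. ((\<lambda>s. \<Phi> s v) has_vector_derivative
              frechet_derivative (ham_vf H) (at (x t)) (\<Phi> t v)) (at t))"

definition spanning_disk :: "ph set \<Rightarrow> (real \<Rightarrow> ph) \<Rightarrow> real \<Rightarrow> (complex \<Rightarrow> ph) \<Rightarrow> bool" where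
  "spanning_disk S x T u \<longleftrightarrow> continuous_on (cball 0 1) u \<and> u ` cball 0 1 \<subseteq> S \<and>
     (\<forall>t\<in>{0..T}. u (cis (2 * pi * t / T)) = x t)"

definition symp_frame :: "(ph \<Rightarrow> real) \<Rightarrow> (complex \<Rightarrow> ph) \<Rightarrow> (complex \<Rightarrow> ph) \<Rightarrow> (complex \<Rightarrow> ph) \<Rightarrow> bool" where
  "symp_frame H u e1 e2 \<longleftrightarrow> continuous_on (cball 0 1) e1 \<and> continuous_on (cball 0 1) e2 \<and>
     (\<forall>z\<in>cball 0 1. e1 z \<in> transv H (u z) \<and> e2 z \<in> transv H (u z) \<and> symp (e1 z) (e2 z) = 1)"

definition triv_path :: "real \<Rightarrow> (real \<Rightarrow> ph \<Rightarrow> ph) \<Rightarrow> (complex \<Rightarrow> ph) \<Rightarrow> (complex \<Rightarrow> ph)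
     \<Rightarrow> complex \<Rightarrow> real \<Rightarrow> complex" where
  "triv_path T \<Phi> e1 e2 z t =
     (let f1 = e1 (cis (2 * pi * t / T)); f2 = e2 (cis (2 * pi * t / T));
          v = Re z *\<^sub>R e1 1 + Im z *\<^sub>R e2 1;
          w = \<Phi> t v
      in Complex (symp w f2) (symp f1 w))"

definition winding_set :: "real \<Rightarrow> (real \<Rightarrow> ph \<Rightarrow> ph) \<Rightarrow> (complex \<Rightarrow> ph) \<Rightarrow> (complex \<Rightarrow> ph) \<Rightarrow> real set" where
  "winding_set T \<Phi> e1 e2 = {d. \<exists>z. z \<noteq> 0 \<and> (\<exists>\<theta>. continuous_on {0..T} \<theta> \<and>
       (\<forall>t\<in>{0..T}. triv_path T \<Phi> e1 e2 z t =
            complex_of_real (cmod (triv_path T \<Phi> e1 e2 z t)) * cis (2 * pi * \<theta> t)) \<and>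
       d = \<theta> T - \<theta> 0)}"

text \<open>HWZ Conley-Zehnder index from the winding interval I = [a,b] (extended to degenerate
  paths as in HWZ, i.e. by the rule applied to I shifted by a small negative amount):
  2k if an integer k lies in [a,b), otherwise 2*ceiling(b) - 1.\<close>
definition hwz_index :: "real set \<Rightarrow> int" where
  "hwz_index I = (if \<exists>k::int. Inf I \<le> of_int k \<and> of_int k < Sup I
                  then 2 * (THE k::int. Inf I \<le> of_int k \<and> of_int k < Sup I)
                  else 2 * \<lceil>Sup I\<rceil> - 1)"

end

theory Submission
  imports Defs
begin

text \<open>The regularized Hamiltonian is a sum of two one-degree-of-freedom systems, each confined to
  a potential well with a nondegenerate minimum. Identify the phase space with the complex plane
  squared and let \<open>X = (X1, X2)\<close> be the Hamiltonian vector field. The class of a tangent vector \<open>w\<close>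
  modulo \<open>X\<close> is measured by the complex determinant \<open>det (X, w)\<close>, and this coordinate comes from a frame
  defined on the whole hypersurface, hence it has the same rotation as any frame that extends
  over a spanning disk.

  If both factors move, \<open>w = (X1, 0)\<close> is invariant under the linearized flow and its determinant
  is \<open>- X1 X2\<close>, which winds once per oscillation of each factor, so at least twice in total; all other
  vectors differ by less than half a turn. If one factor rests at its minimum, the
  determinant is the velocity of the other factor times a vector rotating positively under the
  linearization at the minimum, and its winding exceeds 1. So every transverse
  vector makes more than one full turn, which forces the index to be at least 3.\<close>

subsection \<open>Angles along nonvanishing planar paths\<close>

text \<open>Angles count full turns. The clause repeats the one inside \<open>winding_set\<close>,
  so that the winding set unfolds to the displacements \<open>\<theta> T - \<theta> 0\<close> of
  such lifts.\<close>

definition angle_lift :: "real \<Rightarrow> (real \<Rightarrow> complex) \<Rightarrow> (real \<Rightarrow> real) \<Rightarrow> bool" where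
  "angle_lift T \<gamma> \<theta> \<longleftrightarrow> continuous_on {0..T} \<theta> \<and>
     (\<forall>t\<in>{0..T}. \<gamma> t = complex_of_real (cmod (\<gamma> t)) * cis (2 * pi * \<theta> t))"

lemma angle_liftD:
  assumes "angle_lift T \<gamma> \<theta>" "t \<in> {0..T}"
  shows "\<gamma> t = complex_of_real (cmod (\<gamma> t)) * cis (2 * pi * \<theta> t)"
  using assms by (simp add: angle_lift_def)

lemma exp_angle: "exp w = complex_of_real (cmod (exp w)) * cis (2 * pi * (Im w / (2 * pi)))"
  using exp_eq_polar[of w] by (simp add: norm_mult)

lemma angle_lift_exists:
  assumes "continuous_on {0..T} \<gamma>" "\<And>t. t \<in> {0..T} \<Longrightarrow> \<gamma> t \<noteq> 0"
  obtains \<theta> where "angle_lift T \<gamma> \<theta>"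
proof -
  have "contractible {0..T}" by (simp add: convex_imp_contractible)
  then obtain g where g: "continuous_on {0..T} g" "\<And>t. t \<in> {0..T} \<Longrightarrow> \<gamma> t = exp (g t)"
    using continuous_logarithm_on_contractible[OF assms(1)] assms(2) by metis
  have "angle_lift T \<gamma> (\<lambda>t. Im (g t) / (2 * pi))"
    unfolding angle_lift_def
  proof (intro conjI ballI)
    show "continuous_on {0..T} (\<lambda>t. Im (g t) / (2 * pi))"
      using g(1) by (auto intro!: continuous_intros)
    show "\<gamma> t = complex_of_real (cmod (\<gamma> t)) * cis (2 * pi * (Im (g t) / (2 * pi)))"
      if "t \<in> {0..T}" for t
      using g(2)[OF that] exp_angle[of "g t"] by metis
  qed
  then show thesis by (rule that)
qed

lemma angle_lift_mult:
  assumes "angle_lift T a \<alpha>" "angle_lift T b \<beta>"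
  shows "angle_lift T (\<lambda>t. a t * b t) (\<lambda>t. \<alpha> t + \<beta> t)"
  unfolding angle_lift_def
proof (intro conjI ballI)
  show "continuous_on {0..T} (\<lambda>t. \<alpha> t + \<beta> t)"
    using assms by (auto simp: angle_lift_def intro!: continuous_intros)
  fix t assume t: "t \<in> {0..T}"
  have "a t * b t = (complex_of_real (cmod (a t)) * cis (2 * pi * \<alpha> t)) *
      (complex_of_real (cmod (b t)) * cis (2 * pi * \<beta> t))"
    using angle_liftD[OF assms(1) t] angle_liftD[OF assms(2) t] by simp
  then show "a t * b t = complex_of_real (cmod (a t * b t)) * cis (2 * pi * (\<alpha> t + \<beta> t))"
    by (simp add: norm_mult cis_mult[symmetric] distrib_left)
qed

lemma cnj_mult_lift:
  assumes "angle_lift T a \<alpha>" "angle_lift T b \<beta>" "t \<in> {0..T}"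
  shows "cnj (a t) * b t = complex_of_real (cmod (a t) * cmod (b t)) * cis (2 * pi * (\<beta> t - \<alpha> t))"
proof -
  have "cnj (a t) * b t = cnj (complex_of_real (cmod (a t)) * cis (2 * pi * \<alpha> t)) *
      (complex_of_real (cmod (b t)) * cis (2 * pi * \<beta> t))"
    using angle_liftD[OF assms(1,3)] angle_liftD[OF assms(2,3)] by simp
  then show ?thesis
    by (simp add: cis_cnj cis_mult algebra_simps)
qed

lemma Im_cnj_mult_lift:
  assumes "angle_lift T a \<alpha>" "angle_lift T b \<beta>" "t \<in> {0..T}"
  shows "Im (cnj (a t) * b t) = cmod (a t) * cmod (b t) * sin (2 * pi * (\<beta> t - \<alpha> t))"
    and "Re (cnj (a t) * b t) = cmod (a t) * cmod (b t) * cos (2 * pi * (\<beta> t - \<alpha> t))"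
  using cnj_mult_lift[OF assms] by simp_all

lemma sin_turns_eq_0_iff: "sin (2 * pi * x) = 0 \<longleftrightarrow> (\<exists>k::int. x = of_int k / 2)"
  by (auto simp: sin_zero_iff_int2 field_simps)

text \<open>Multiples of 1/2 are the angles between parallel or opposite directions. A closed
  interval of length at least 1/2 contains one, here the least one not below the smaller end value,
  and the intermediate value theorem supplies the time.\<close>

lemma crosses_half_integer:
  fixes g :: "real \<Rightarrow> real"
  assumes "0 \<le> T" "continuous_on {0..T} g" "\<bar>g T - g 0\<bar> \<ge> 1 / 2"
  shows "\<exists>t\<in>{0..T}. \<exists>k::int. g t = of_int k / 2"
proof -
  define k where "k = \<lceil>2 * min (g 0) (g T)\<rceil>"
  have k: "min (g 0) (g T) \<le> of_int k / 2" "of_int k / 2 < min (g 0) (g T) + 1 / 2"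
    unfolding k_def by linarith+
  consider "g 0 \<le> of_int k / 2" "of_int k / 2 \<le> g T" | "g T \<le> of_int k / 2" "of_int k / 2 \<le> g 0"
    using k assms(3) by linarith
  then show ?thesis
  proof cases
    case 1
    then show ?thesis using IVT'[of g 0 "of_int k / 2" T] assms by auto
  next
    case 2
    then show ?thesis using IVT2'[of g T "of_int k / 2" 0] assms by auto
  qed
qed

text \<open>Both directions span the same real line at each time, so the difference of the lifts
  takes values in the discrete set of multiples of 1/2 and is constant by continuity.\<close>

lemma angle_lift_eq_of_real_ratio:
  assumes "0 \<le> T" "angle_lift T a \<alpha>" "angle_lift T b \<beta>"
    and "\<And>t. t \<in> {0..T} \<Longrightarrow> a t \<noteq> 0" "\<And>t. t \<in> {0..T} \<Longrightarrow> b t \<noteq> 0"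
    and "\<And>t. t \<in> {0..T} \<Longrightarrow> Im (cnj (a t) * b t) = 0"
  shows "\<beta> T - \<beta> 0 = \<alpha> T - \<alpha> 0"
proof -
  define g where "g t = \<beta> t - \<alpha> t" for t
  have cont: "continuous_on {0..T} g"
    unfolding g_def using assms(2,3) by (auto simp: angle_lift_def intro!: continuous_intros)
  have half: "\<exists>k::int. g t = of_int k / 2" if "t \<in> {0..T}" for t
    using Im_cnj_mult_lift(1)[OF assms(2,3) that] assms(4-6)[OF that]
    unfolding g_def sin_turns_eq_0_iff[symmetric] by simp
  have "g constant_on {0..T}"
  proof (rule continuous_discrete_range_constant[OF _ cont])
    fix x assume x: "x \<in> {0..T}"
    show "\<exists>e>0. \<forall>y. y \<in> {0..T} \<and> g y \<noteq> g x \<longrightarrow> e \<le> norm (g y - g x)"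
    proof (intro exI[of _ "1/2"] conjI allI impI)
      fix y assume y: "y \<in> {0..T} \<and> g y \<noteq> g x"
      obtain k j :: int where "g x = of_int k / 2" "g y = of_int j / 2" using half x y by metis
      moreover from this y have "j \<noteq> k" by auto
      then have "\<bar>of_int j - of_int k :: real\<bar> \<ge> 1" by linarith
      ultimately show "1/2 \<le> norm (g y - g x)" unfolding real_norm_def by linarith
    qed simp
  qed simp
  then have "g T = g 0" using assms(1) by (auto simp: constant_on_def)
  then show ?thesis by (simp add: g_def)
qed

lemma angle_lift_unique:
  assumes "0 \<le> T" "angle_lift T a \<alpha>" "angle_lift T a \<beta>" "\<And>t. t \<in> {0..T} \<Longrightarrow> a t \<noteq> 0"
  shows "\<beta> T - \<beta> 0 = \<alpha> T - \<alpha> 0"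
  by (rule angle_lift_eq_of_real_ratio[OF assms(1-3) assms(4) assms(4)]) (auto simp: algebra_simps)

text \<open>A comparison principle. For \<sigma> = 0 the paths stay collinear and turn equally.
  Otherwise they are never collinear, so the difference of the lifts meets no multiple of 1/2 and
  changes by less than 1/2.\<close>

lemma angle_lift_close:
  assumes "0 \<le> T" "angle_lift T a \<alpha>" "angle_lift T b \<beta>"
    and "\<And>t. t \<in> {0..T} \<Longrightarrow> a t \<noteq> 0" "\<And>t. t \<in> {0..T} \<Longrightarrow> b t \<noteq> 0"
    and "\<And>t. t \<in> {0..T} \<Longrightarrow> sgn (Im (cnj (a t) * b t)) = \<sigma>"
  shows "\<bar>(\<beta> T - \<beta> 0) - (\<alpha> T - \<alpha> 0)\<bar> < 1 / 2"
proof (cases "\<sigma> = 0")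
  case True
  then have "Im (cnj (a t) * b t) = 0" if "t \<in> {0..T}" for t
    using assms(6)[OF that] by (simp add: sgn_zero_iff)
  then show ?thesis using angle_lift_eq_of_real_ratio[OF assms(1-5)] by simp
next
  case False
  show ?thesis
  proof (rule ccontr)
    assume "\<not> ?thesis"
    moreover have "continuous_on {0..T} (\<lambda>t. \<beta> t - \<alpha> t)"
      using assms(2,3) by (auto simp: angle_lift_def intro!: continuous_intros)
    ultimately obtain t where t: "t \<in> {0..T}" "\<exists>k::int. \<beta> t - \<alpha> t = of_int k / 2"
      using crosses_half_integer[of T "\<lambda>t. \<beta> t - \<alpha> t"] assms(1) by (auto simp: algebra_simps)
    then have "Im (cnj (a t) * b t) = 0"
      using Im_cnj_mult_lift(1)[OF assms(2,3) t(1)] sin_turns_eq_0_iff by simp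
    then show False using assms(6)[OF t(1)] False by simp
  qed
qed

lemma angle_lift_loop:
  assumes "0 \<le> T" "angle_lift T a \<alpha>" "a T = a 0" "a 0 \<noteq> 0"
  shows "\<alpha> T - \<alpha> 0 \<in> \<int>"
proof -
  have "complex_of_real (cmod (a 0)) * cis (2 * pi * \<alpha> T) = complex_of_real (cmod (a 0)) * cis (2 * pi * \<alpha> 0)"
    using angle_liftD[OF assms(2), of 0] angle_liftD[OF assms(2), of T] assms by simp
  then have "cis (2 * pi * \<alpha> T) = cis (2 * pi * \<alpha> 0)" using assms(4) by simp
  then have "cis (2 * pi * \<alpha> T) / cis (2 * pi * \<alpha> 0) = 1" by simp
  then have "cis (2 * pi * (\<alpha> T - \<alpha> 0)) = 1" by (simp add: cis_divide algebra_simps)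
  then have "cos (2 * pi * (\<alpha> T - \<alpha> 0)) = 1" by (metis cis.sel(1) one_complex.sel(1))
  then obtain k :: int where "2 * pi * (\<alpha> T - \<alpha> 0) = of_int k * 2 * pi"
    using cos_one_2pi_int by auto
  then have "\<alpha> T - \<alpha> 0 = of_int k" by simp
  then show ?thesis by simp
qed

text \<open>The angular velocity \<open>Im (a' t / a t) / (2 * pi)\<close> has the sign of
  \<open>Im (cnj (a t) * a' t)\<close>. Integrating \<open>a' / a\<close> gives a differentiable
  lift, and the displacement does not depend on the lift.\<close>

lemma angle_lift_increases:
  assumes "0 < T" "angle_lift T a \<alpha>" "\<And>t. t \<in> {0..T} \<Longrightarrow> a t \<noteq> 0"
    and der: "\<And>t. t \<in> {0..T} \<Longrightarrow> (a has_vector_derivative a' t) (at t within {0..T})"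
    and cont: "continuous_on {0..T} a'"
    and pos: "\<And>t. t \<in> {0..T} \<Longrightarrow> Im (cnj (a t) * a' t) > 0"
  shows "\<alpha> T - \<alpha> 0 > 0"
proof -
  have ca: "continuous_on {0..T} a"
    using der by (meson continuous_on_eq_continuous_within has_vector_derivative_continuous)
  have "continuous_on {0..T} (\<lambda>t. a' t / a t)"
    using ca cont assms(3) by (intro continuous_intros) auto
  then obtain G where G: "\<And>t. t \<in> {0..T} \<Longrightarrow> (G has_vector_derivative a' t / a t) (at t within {0..T})"
    using antiderivative_continuous by blast
  \<comment> \<open>The primitive \<open>G\<close> of the logarithmic derivative is a logarithm of
    \<open>a\<close> up to an additive constant.\<close>
  have zero: "((\<lambda>t. a t * exp (- G t)) has_vector_derivative 0) (at t within {0..T})" if t: "t \<in> {0..T}" for t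
  proof -
    have "((\<lambda>t. exp (- G t)) has_vector_derivative (- (a' t / a t)) * exp (- G t)) (at t within {0..T})"
      using field_vector_diff_chain_within[of "\<lambda>t. - G t" "- (a' t / a t)" t "{0..T}" exp "exp (- G t)"]
        G[OF t] by (auto simp: o_def intro!: derivative_eq_intros has_vector_derivative_minus DERIV_subset[OF DERIV_exp])
    from has_vector_derivative_mult[OF der[OF t] this] show ?thesis
      using assms(3)[OF t] by (simp add: field_simps)
  qed
  obtain C where C: "\<And>t. t \<in> {0..T} \<Longrightarrow> a t * exp (- G t) = C"
    using has_vector_derivative_zero_constant[of "{0..T}" "\<lambda>t. a t * exp (- G t)"] zero by auto
  have aG: "a t = C * exp (G t)" if "t \<in> {0..T}" for t
    using C[OF that] by (simp add: exp_minus field_simps)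
  have "C \<noteq> 0" using aG[of 0] assms(1) assms(3)[of 0] by auto
  then obtain c where c: "C = exp c" by (metis exp_Ln)
  define \<beta> where "\<beta> t = Im (c + G t) / (2 * pi)" for t
  have Gd: "((\<lambda>t. Im (G t)) has_real_derivative Im (a' t / a t)) (at t within {0..T})" if "t \<in> {0..T}" for t
    using bounded_linear.has_vector_derivative[OF bounded_linear_Im G[OF that]]
    by (simp add: has_real_derivative_iff_has_vector_derivative)
  have cG: "continuous_on {0..T} G"
    using G by (meson continuous_on_eq_continuous_within has_vector_derivative_continuous)
  have "angle_lift T a \<beta>"
    unfolding angle_lift_def \<beta>_def
  proof (intro conjI ballI)
    show "continuous_on {0..T} (\<lambda>t. Im (c + G t) / (2 * pi))"
      using cG by (auto intro!: continuous_intros)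
    show "a t = complex_of_real (cmod (a t)) * cis (2 * pi * (Im (c + G t) / (2 * pi)))"
      if "t \<in> {0..T}" for t
      using exp_angle[of "c + G t"] aG[OF that] c by (simp add: exp_add)
  qed
  then have "\<alpha> T - \<alpha> 0 = \<beta> T - \<beta> 0"
    using angle_lift_unique assms(1-3) by (meson less_eq_real_def)
  moreover have "\<dots> = (Im (G T) - Im (G 0)) / (2 * pi)" by (simp add: \<beta>_def diff_divide_distrib add_divide_distrib)
  moreover have "Im (G T) - Im (G 0) > 0"
  proof -
    have "\<exists>x\<in>{0<..<T}. Im (G T) - Im (G 0) = Im (a' x / a x) * (T - 0)"
      using assms(1) Gd by (intro mvt_simple) (auto simp: has_field_derivative_def)
    then obtain x where x: "0 < x" "x < T" "Im (G T) - Im (G 0) = T * Im (a' x / a x)"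
      by (auto simp: mult.commute)
    have "a' x / a x = cnj (a x) * a' x / (cmod (a x))\<^sup>2"
      using assms(3)[of x] x by (simp add: complex_div_cnj[of "a' x"] mult.commute)
    then have "Im (a' x / a x) = Im (cnj (a x) * a' x) / (cmod (a x))\<^sup>2"
      by (metis Im_divide_of_real of_real_power)
    also have "\<dots> > 0" using pos[of x] x assms(3)[of x] by simp
    finally show ?thesis using x assms(1) by simp
  qed
  ultimately show ?thesis by simp
qed

text \<open>The sign hypotheses place both paths, relative to their starting directions, in the same
  open half plane or on the same ray. This is what survives an orientation preserving real linear
  map; exact angles do not, but exceeding a full turn does.\<close>

lemma angle_lift_gt_1_transfer:
  assumes "0 \<le> T" "angle_lift T a \<alpha>" "angle_lift T b \<beta>"
    and "\<And>t. t \<in> {0..T} \<Longrightarrow> a t \<noteq> 0" "\<And>t. t \<in> {0..T} \<Longrightarrow> b t \<noteq> 0"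
    and im: "\<And>t. t \<in> {0..T} \<Longrightarrow> sgn (Im (cnj (a 0) * a t)) = sgn (Im (cnj (b 0) * b t))"
    and re: "\<And>t. t \<in> {0..T} \<Longrightarrow> Im (cnj (a 0) * a t) = 0 \<Longrightarrow>
               sgn (Re (cnj (a 0) * a t)) = sgn (Re (cnj (b 0) * b t))"
    and "\<alpha> T - \<alpha> 0 > 1"
  shows "\<beta> T - \<beta> 0 > 1"
proof -
  define A where "A t = \<alpha> t - \<alpha> 0" for t
  define B where "B t = \<beta> t - \<beta> 0" for t
  have lin: "Im (cnj (f 0) * f t) = cmod (f 0) * cmod (f t) * sin (2 * pi * (\<phi> t - \<phi> 0))"
       "Re (cnj (f 0) * f t) = cmod (f 0) * cmod (f t) * cos (2 * pi * (\<phi> t - \<phi> 0))"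
    if "angle_lift T f \<phi>" "t \<in> {0..T}" for f \<phi> t
  proof -
    have "angle_lift T (\<lambda>_. f 0) (\<lambda>_. \<phi> 0)"
      using that by (auto simp: angle_lift_def)
    from Im_cnj_mult_lift[OF this that] 
    show "Im (cnj (f 0) * f t) = cmod (f 0) * cmod (f t) * sin (2 * pi * (\<phi> t - \<phi> 0))"
       "Re (cnj (f 0) * f t) = cmod (f 0) * cmod (f t) * cos (2 * pi * (\<phi> t - \<phi> 0))" by simp_all
  qed
  have 0: "0 \<in> {0..T}" using assms(1) by simp
  have s: "sgn (sin (2 * pi * A t)) = sgn (sin (2 * pi * B t))" if "t \<in> {0..T}" for t
    using im[OF that] lin(1)[OF assms(2) that] lin(1)[OF assms(3) that] assms(4)[OF 0] assms(5)[OF 0]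
      assms(4)[OF that] assms(5)[OF that] by (simp add: A_def B_def sgn_mult)
  have c: "sgn (cos (2 * pi * A t)) = sgn (cos (2 * pi * B t))"
    if "t \<in> {0..T}" "sin (2 * pi * A t) = 0" for t
    using re[OF that(1)] lin[OF assms(2) that(1)] lin[OF assms(3) that(1)] assms(4)[OF 0] assms(5)[OF 0]
      assms(4)[OF that(1)] assms(5)[OF that(1)] that(2) by (simp add: A_def B_def sgn_mult)
  \<comment> \<open>An offset of half a turn would reverse the signs of both sine and cosine; their
    agreement would then force both to vanish.\<close>
  have ne: "A t - B t \<noteq> 1/2" "A t - B t \<noteq> -1/2" if t: "t \<in> {0..T}" for t
  proof -
    have False if "2 * pi * A t = 2 * pi * B t + pi \<or> 2 * pi * B t = 2 * pi * A t + pi"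
    proof -
      from that have "sin (2 * pi * A t) = - sin (2 * pi * B t)" "cos (2 * pi * A t) = - cos (2 * pi * B t)"
        by (auto simp: sin_add cos_add)
      with s[OF t] c[OF t] have "sin (2 * pi * A t) = 0" "cos (2 * pi * A t) = 0"
        by (auto simp: sgn_if split: if_splits)
      then show False using sin_cos_squared_add[of "2 * pi * A t"] by simp
    qed
    moreover have "2 * pi * A t = 2 * pi * B t + pi" if "A t - B t = 1/2"
    proof -
      from that have "A t = B t + 1/2" by simp
      then show ?thesis by (simp add: distrib_left)
    qed
    moreover have "2 * pi * B t = 2 * pi * A t + pi" if "A t - B t = -1/2"
    proof -
      from that have "B t = A t + 1/2" by simp
      then show ?thesis by (simp add: distrib_left)
    qed
    ultimately show "A t - B t \<noteq> 1/2" "A t - B t \<noteq> -1/2" by blast+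
  qed
  have cont: "continuous_on {0..T} (\<lambda>t. A t - B t)"
    unfolding A_def B_def using assms(2,3) by (auto simp: angle_lift_def intro!: continuous_intros)
  have "A 0 - B 0 = 0" by (simp add: A_def B_def)
  then have "A T - B T < 1/2"
    using IVT'[of "\<lambda>t. A t - B t" 0 "1/2" T] cont assms(1) ne by fastforce
  show ?thesis
  proof (rule ccontr)
    assume "\<not> ?thesis"
    then have B: "B T \<le> 1" "B T > 1/2" "A T > 1" "A T < 3/2"
      using \<open>A T - B T < 1/2\<close> assms(8) by (auto simp: A_def B_def)
    \<comment> \<open>\<open>A T\<close> lies in (1, 3/2), where the sine is positive, and
      \<open>B T\<close> in (1/2, 1], where it is not.\<close>
    have "sin (2 * pi * (A T - 1)) > 0"
      using B by (intro sin_gt_zero) auto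
    then have "sin (2 * pi * A T) > 0" by (simp add: right_diff_distrib sin_diff)
    moreover have "sin (2 * pi * (1 - B T)) \<ge> 0"
      using B by (intro sin_ge_zero) auto
    then have "sin (2 * pi * B T) \<le> 0" by (simp add: right_diff_distrib sin_diff)
    ultimately show False using s[of T] assms(1) by (auto simp: sgn_if split: if_splits)
  qed
qed

subsection \<open>Trivializations over a disk and the index\<close>

text \<open>Up to the positive factor \<open>Im (cnj s1 * s2)\<close>, the two entries are the
  coordinates of \<open>d\<close> in the basis \<open>s1\<close>, \<open>s2\<close>.\<close>

lemma positive_frame_neq_0:
  assumes "Im (cnj s1 * s2) > 0" "d \<noteq> 0"
  shows "Complex (- Im (cnj s2 * d)) (Im (cnj s1 * d)) \<noteq> 0"
proof
  assume "Complex (- Im (cnj s2 * d)) (Im (cnj s1 * d)) = 0"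
  then have z: "Im (cnj s2 * d) = 0" "Im (cnj s1 * d) = 0" by (auto simp: complex_eq_iff)
  have "of_real (Im (cnj s1 * s2)) * d = of_real (Im (cnj s1 * d)) * s2 - of_real (Im (cnj s2 * d)) * s1"
    by (auto simp: complex_eq_iff algebra_simps)
  then have "of_real (Im (cnj s1 * s2)) * d = 0" unfolding z by simp
  then show False using assms by (metis less_irrefl mult_eq_0_iff of_real_eq_0_iff)
qed

lemma positive_frame_area:
  "Im (cnj (Complex (- Im (cnj s2 * d)) (Im (cnj s1 * d))) *
       Complex (- Im (cnj s2 * d')) (Im (cnj s1 * d'))) =
   Im (cnj s1 * s2) * Im (cnj d * d')"
  by (simp add: algebra_simps)

text \<open>The frame along the boundary circle contracts through the disk to the constant frame at
  1. Concretely, the coordinates of \<open>d t\<close> in the frame at \<open>z\<close> never vanish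
  on the contractible set of all pairs \<open>(z, t)\<close>, so they have one logarithm there. For
  the constant frame the coordinates are a fixed linear function of \<open>d\<close>.\<close>

lemma angle_lift_gt_1_disk_frame:
  fixes s1 s2 :: "complex \<Rightarrow> complex"
  assumes T: "0 < T" and cs: "continuous_on (cball 0 1) s1" "continuous_on (cball 0 1) s2"
    and pos: "\<And>z. z \<in> cball 0 1 \<Longrightarrow> Im (cnj (s1 z) * s2 z) > 0"
    and d: "continuous_on {0..T} d" "\<And>t. t \<in> {0..T} \<Longrightarrow> d t \<noteq> 0" "angle_lift T d \<delta>" "\<delta> T - \<delta> 0 > 1"
    and P: "\<And>t. t \<in> {0..T} \<Longrightarrow> P t = Complex (- Im (cnj (s2 (cis (2 * pi * t / T))) * d t))
              (Im (cnj (s1 (cis (2 * pi * t / T))) * d t))"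
    and \<theta>: "angle_lift T P \<theta>"
  shows "\<theta> T - \<theta> 0 > 1"
proof -
  define G where "G = (\<lambda>(z, t). Complex (- Im (cnj (s2 z) * d t)) (Im (cnj (s1 z) * d t)))"
  let ?S = "cball (0::complex) 1 \<times> {0..T}"
  have G0: "G w \<noteq> 0" if "w \<in> ?S" for w
    using that positive_frame_neq_0 pos d(2) by (auto simp: G_def)
  have cd: "continuous_on ?S (\<lambda>w. d (snd w))"
    by (rule continuous_on_compose2[OF d(1)]) (auto intro!: continuous_intros)
  have cs': "continuous_on ?S (\<lambda>w. s1 (fst w))" "continuous_on ?S (\<lambda>w. s2 (fst w))"
    by (rule continuous_on_compose2[OF cs(1)] continuous_on_compose2[OF cs(2)]; auto intro!: continuous_intros)+
  have "continuous_on ?S G"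
    unfolding G_def case_prod_unfold Complex_eq using cd cs' by (intro continuous_intros) auto
  moreover have "contractible ?S" by (intro convex_imp_contractible convex_Times) auto
  ultimately obtain g where g: "continuous_on ?S g" "\<And>w. w \<in> ?S \<Longrightarrow> G w = exp (g w)"
    using continuous_logarithm_on_contractible G0 by metis
  have lift: "angle_lift T (\<lambda>t. G (\<gamma> t, t)) (\<lambda>t. Im (g (\<gamma> t, t)) / (2 * pi))"
    if \<gamma>: "continuous_on {0..T} \<gamma>" "\<And>t. t \<in> {0..T} \<Longrightarrow> \<gamma> t \<in> cball 0 1" for \<gamma>
    unfolding angle_lift_def
  proof (intro conjI ballI)
    have "continuous_on {0..T} (\<lambda>t. g (\<gamma> t, t))"
      by (rule continuous_on_compose2[OF g(1)])
        (use \<gamma> in \<open>auto intro!: continuous_intros simp del: mem_cball\<close>)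
    then show "continuous_on {0..T} (\<lambda>t. Im (g (\<gamma> t, t)) / (2 * pi))"
      by (auto intro!: continuous_intros)
    show "G (\<gamma> t, t) = complex_of_real (cmod (G (\<gamma> t, t))) * cis (2 * pi * (Im (g (\<gamma> t, t)) / (2 * pi)))"
      if "t \<in> {0..T}" for t
    proof -
      have "(\<gamma> t, t) \<in> ?S" using \<gamma>(2) that by (auto simp del: mem_cball)
      from g(2)[OF this] show ?thesis using exp_angle[of "g (\<gamma> t, t)"] by metis
    qed
  qed
  define c where "c t = cis (2 * pi * t / T)" for t
  have c: "continuous_on {0..T} c" "\<And>t. t \<in> {0..T} \<Longrightarrow> c t \<in> cball 0 1" "c 0 = 1" "c T = 1"
    unfolding c_def using T by (auto intro!: continuous_intros)
  have PG: "P t = G (c t, t)" if "t \<in> {0..T}" for t using P[OF that] by (simp add: G_def c_def)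
  have "angle_lift T P (\<lambda>t. Im (g (c t, t)) / (2 * pi))"
    using lift[OF c(1,2)] PG by (simp add: angle_lift_def)
  moreover have "P t \<noteq> 0" if "t \<in> {0..T}" for t
    using PG[OF that] G0[of "(c t, t)"] c(2)[OF that] that by auto
  \<comment> \<open>The boundary path and the constant path at 1 both lead from
    \<open>(1, 0)\<close> to \<open>(1, T)\<close>, so \<open>g\<close> gives them the same
    displacement.\<close>
  ultimately have "\<theta> T - \<theta> 0 = Im (g (1, T)) / (2 * pi) - Im (g (1, 0)) / (2 * pi)"
    using angle_lift_unique[of T P _ \<theta>] \<theta> T c(3,4) by fastforce
  moreover have "Im (g (1, T)) / (2 * pi) - Im (g (1, 0)) / (2 * pi) > 1"
  proof (rule angle_lift_gt_1_transfer[OF _ d(3) lift[of "\<lambda>_. 1"] d(2) _ _ _ d(4)])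
    have p: "Im (cnj (s1 1) * s2 1) > 0" using pos by simp
    have "Im (cnj (G (1, 0)) * G (1, t)) = Im (cnj (s1 1) * s2 1) * Im (cnj (d 0) * d t)" for t
      unfolding G_def prod.case by (rule positive_frame_area)
    then show "sgn (Im (cnj (d 0) * d t)) = sgn (Im (cnj (G (1, 0)) * G (1, t)))" for t
      using p by (simp only: sgn_mult) simp
    show "sgn (Re (cnj (d 0) * d t)) = sgn (Re (cnj (G (1, 0)) * G (1, t)))"
      if "t \<in> {0..T}" "Im (cnj (d 0) * d t) = 0" for t
    proof -
      have d0: "d 0 \<noteq> 0" using d(2) T by simp
      have G10: "G (1, 0) \<noteq> 0" using G0 T by simp
      \<comment> \<open>When \<open>d t\<close> lies on the line of \<open>d 0\<close> it is the
        real multiple \<open>r\<close> of it, and real linearity carries the same \<open>r\<close>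
        over to \<open>G\<close>.\<close>
      define r where "r = Re (cnj (d 0) * d t) / (cmod (d 0))\<^sup>2"
      have "cnj (d 0) * d t = of_real (Re (cnj (d 0) * d t))" using that(2) by (simp add: complex_eq_iff)
      then have "d 0 * cnj (d 0) * d t = of_real (Re (cnj (d 0) * d t)) * d 0" by (simp add: mult_ac)
      then have "d t = of_real r * d 0"
        unfolding complex_norm_square[symmetric] r_def using d0 by (simp add: field_simps)
      then have "G (1, t) = of_real r * G (1, 0)" by (simp add: G_def complex_eq_iff algebra_simps)
      then have "cnj (G (1, 0)) * G (1, t) = of_real (r * (cmod (G (1, 0)))\<^sup>2)"
        unfolding of_real_mult complex_norm_square by (simp add: mult_ac)
      then have "Re (cnj (G (1, 0)) * G (1, t)) = r * (cmod (G (1, 0)))\<^sup>2" by simp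
      then show ?thesis using G10 d0 by (simp only: sgn_mult) (simp add: r_def sgn_divide)
    qed
  qed (use T G0 in \<open>auto intro!: continuous_intros\<close>)
  ultimately show ?thesis by simp
qed

section \<open>From displacements to the Conley-Zehnder index\<close>

lemma cmod_cis_minus_1_le: "cmod (cis x - 1) \<le> \<bar>x\<bar>"
proof -
  have "(cmod (cis x - 1))\<^sup>2 = (cos x - 1)\<^sup>2 + (sin x)\<^sup>2" by (simp add: cmod_power2)
  also have "\<dots> = 2 - 2 * cos (2 * (x / 2))"
    using sin_cos_squared_add[of x] by (simp add: power2_eq_square algebra_simps)
  also have "\<dots> = (2 * sin (x / 2))\<^sup>2"
    unfolding cos_double_sin by (simp add: power2_eq_square)
  finally have "cmod (cis x - 1) = \<bar>2 * sin (x / 2)\<bar>"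
    by (metis abs_norm_cancel real_sqrt_abs)
  then show ?thesis using abs_sin_x_le_abs_x[of "x / 2"] by simp
qed

text \<open>The interval has length at most 1/2, so it contains at most one integer. Such an integer
  is at least 2 and gives index at least 4; otherwise the ceiling is at least 2 and gives at least
  3. The uniform gap matters: since the rule includes the left end, infimum 1 with a larger supremum
  would give index 2.\<close>

lemma hwz_index_ge_3:
  fixes W :: "real set"
  assumes W: "W \<noteq> {}" and close: "\<And>d d'. d \<in> W \<Longrightarrow> d' \<in> W \<Longrightarrow> \<bar>d - d'\<bar> < 1 / 2"
    and \<epsilon>: "0 < \<epsilon>" "\<And>d. d \<in> W \<Longrightarrow> 1 + \<epsilon> \<le> d"
  shows "3 \<le> hwz_index W"
proof -
  obtain d0 where d0: "d0 \<in> W" using W by auto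
  have bd: "bdd_above W" "bdd_below W"
    using close[OF _ d0] by (meson abs_diff_less_iff bdd_above.I bdd_below.I less_eq_real_def)+
  have inf: "1 + \<epsilon> \<le> Inf W" using W \<epsilon> by (intro cInf_greatest) auto
  have le: "Inf W \<le> Sup W" using W bd by (rule cInf_le_cSup)
  have w: "Sup W \<le> Inf W + 1/2"
  proof (rule cSup_least[OF W])
    fix d assume d: "d \<in> W"
    have "d - 1/2 \<le> Inf W" using W close[OF _ d] by (intro cInf_greatest) force+
    then show "d \<le> Inf W + 1/2" by simp
  qed
  show ?thesis
  proof (cases "\<exists>k::int. Inf W \<le> of_int k \<and> of_int k < Sup W")
    case True
    then obtain k :: int where k: "Inf W \<le> of_int k" "of_int k < Sup W" by auto
    have "(THE k::int. Inf W \<le> of_int k \<and> of_int k < Sup W) = k"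
    proof (rule the_equality)
      fix j :: int assume "Inf W \<le> of_int j \<and> of_int j < Sup W"
      with k w have "\<bar>of_int j - of_int k :: real\<bar> < 1" by linarith
      then show "j = k" by linarith
    qed (use k in simp)
    moreover have "k \<ge> 2" using k inf \<epsilon>(1) by linarith
    ultimately show ?thesis using True by (simp add: hwz_index_def)
  next
    case False
    have "\<lceil>Sup W\<rceil> \<ge> 2" using inf le \<epsilon>(1) by linarith
    then have "3 \<le> 2 * \<lceil>Sup W\<rceil> - 1" by linarith
    then show ?thesis unfolding hwz_index_def if_not_P[OF False] .
  qed
qed

text \<open>Area preservation makes \<open>Im (cnj (P z t) * P w t)\<close> constant in time, so
  displacements differ by less than 1/2. The remaining task is to turn the pointwise bound
  \<open>gt1\<close> into a uniform gap above 1.\<close>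

lemma hwz_index_area_preserving_path:
  fixes P :: "complex \<Rightarrow> real \<Rightarrow> complex"
  assumes T: "0 < T" and P0: "\<And>z. P z 0 = z"
    and cont: "\<And>z. continuous_on {0..T} (P z)"
    and area: "\<And>z w t. t \<in> {0..T} \<Longrightarrow> Im (cnj (P z t) * P w t) = Im (cnj z * w)"
    and gt1: "\<And>z \<theta>. z \<noteq> 0 \<Longrightarrow> angle_lift T (P z) \<theta> \<Longrightarrow> \<theta> T - \<theta> 0 > 1"
  shows "3 \<le> hwz_index {d. \<exists>z. z \<noteq> 0 \<and> (\<exists>\<theta>. angle_lift T (P z) \<theta> \<and> d = \<theta> T - \<theta> 0)}"
    (is "3 \<le> hwz_index ?W")
proof -
  have nz: "P z t \<noteq> 0" if "z \<noteq> 0" "t \<in> {0..T}" for z t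
  proof
    assume "P z t = 0"
    then have "Im (cnj z * (\<i> * z)) = 0" using area[OF that(2), of z "\<i> * z"] by simp
    then have "(Re z)\<^sup>2 + (Im z)\<^sup>2 = 0" by (simp add: power2_eq_square)
    then show False using that(1) by (simp add: complex_eq_iff)
  qed
  have ex: "\<exists>\<theta>. angle_lift T (P z) \<theta>" if "z \<noteq> 0" for z
    using angle_lift_exists[OF cont nz[OF that]] by metis
  have close: "\<bar>d - d'\<bar> < 1 / 2" if dd: "d \<in> ?W" "d' \<in> ?W" for d d'
  proof -
    obtain z \<theta> z' \<theta>' where z: "z \<noteq> 0" "angle_lift T (P z) \<theta>" "d = \<theta> T - \<theta> 0"
      and z': "z' \<noteq> 0" "angle_lift T (P z') \<theta>'" "d' = \<theta>' T - \<theta>' 0"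
      using dd by auto
    show ?thesis unfolding z z'
      by (rule angle_lift_close[OF _ z'(2) z(2) nz[OF z'(1)] nz[OF z(1)]])
         (use T area in simp_all)
  qed
  have mem: "\<theta> T - \<theta> 0 \<in> ?W" if "z \<noteq> 0" "angle_lift T (P z) \<theta>" for z \<theta>
    using that by (intro CollectI exI[of _ z] conjI exI[of _ \<theta>]) simp_all
  obtain \<theta>1 where "angle_lift T (P 1) \<theta>1" using ex[of 1] by auto
  then have ne: "?W \<noteq> {}" using mem[of 1 \<theta>1] by force
  have gt: "d > 1" if "d \<in> ?W" for d using that gt1 by blast
  show ?thesis
  proof (cases "\<exists>d\<in>?W. d \<ge> 2")
    \<comment> \<open>One displacement of at least 2 keeps all others above 3/2.\<close>
    case True
    then obtain d0 where d0: "d0 \<in> ?W" "d0 \<ge> 2" by auto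
    show ?thesis
    proof (rule hwz_index_ge_3[OF ne close])
      show "1 + 1/2 \<le> d" if "d \<in> ?W" for d using close[OF that d0(1)] d0(2) by linarith
    qed simp_all
  next
    case False
    \<comment> \<open>Every displacement lies in (1, 2), so no ray is mapped to itself by the endpoint of the
      path, and the compactness of the circle gives a gap above 1.\<close>
    have lin: "P z T = of_real (Re z) * P 1 T + of_real (Im z) * P \<i> T" for z
    proof -
      have TT: "T \<in> {0..T}" using T by simp
      define A where "A = P 1 T"
      define B where "B = P \<i> T"
      \<comment> \<open>Linearity at time \<open>T\<close> comes from area preservation: the areas
        spanned with \<open>A\<close> and \<open>B\<close> determine the coordinates of
        \<open>P z T\<close> in this unimodular basis.\<close>
      have AB: "Re A * Im B - Im A * Re B = 1"
        using area[OF TT, of 1 \<i>] by (simp add: A_def B_def)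
      have a: "Re A * Im (P z T) - Im A * Re (P z T) = Im z"
        using area[OF TT, of 1 z] by (simp add: A_def)
      have b: "Re B * Im (P z T) - Im B * Re (P z T) = - Re z"
        using area[OF TT, of \<i> z] by (simp add: B_def)
      have "Re (P z T) = Re z * Re A + Im z * Re B" "Im (P z T) = Re z * Im A + Im z * Im B"
        using AB a b by algebra+
      then show ?thesis by (simp add: complex_eq_iff A_def B_def)
    qed
    \<comment> \<open>For unit \<open>z\<close> this compares the direction of the endpoint with the
      starting direction; it equals 1 exactly when the displacement is an integer.\<close>
    define F where "F z = sgn (P z T) / z" for z
    have contF: "continuous_on (sphere 0 1) (\<lambda>z. cmod (F z - 1))"
    proof -
      have "continuous_on (sphere 0 1) (\<lambda>z. of_real (Re z) * P 1 T + of_real (Im z) * P \<i> T)"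
        by (intro continuous_intros)
      then have "continuous_on (sphere 0 1) (\<lambda>z. P z T)"
        by (rule continuous_on_eq) (rule lin[symmetric])
      moreover have "P z T \<noteq> 0" if "z \<in> sphere 0 1" for z
        using nz[of z T] that T by (cases "z = 0") auto
      ultimately show ?thesis unfolding F_def by (intro continuous_intros) auto
    qed
    obtain z0 where z0: "z0 \<in> sphere 0 1" "\<And>z. z \<in> sphere 0 1 \<Longrightarrow> cmod (F z0 - 1) \<le> cmod (F z - 1)"
      using continuous_attains_inf[OF compact_sphere _ contF] by (auto simp: sphere_eq_empty)
    have F: "F (sgn z) = cis (2 * pi * (\<theta> T - \<theta> 0 - 1))" if z: "z \<noteq> 0" "angle_lift T (P z) \<theta>" for z \<theta>
    proof -
      have "P (sgn z) T = P z T / of_real (cmod z)"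
        using lin[of "sgn z"] lin[of z]
        by (simp add: sgn_eq Re_divide_of_real Im_divide_of_real add_divide_distrib)
      moreover have "sgn (P z T) = cis (2 * pi * \<theta> T)"
        using angle_liftD[OF z(2), of T] T nz[OF z(1), of T] by (simp add: sgn_eq) (metis mult.commute nonzero_mult_div_cancel_right norm_eq_zero of_real_eq_0_iff)
      moreover have "sgn z = cis (2 * pi * \<theta> 0)"
        using angle_liftD[OF z(2), of 0] T P0 z(1) by (simp add: sgn_eq) (metis mult.commute nonzero_mult_div_cancel_right norm_eq_zero of_real_eq_0_iff)
      moreover have "cis (2 * pi * (\<theta> T - \<theta> 0 - 1)) = cis (2 * pi * \<theta> T) / cis (2 * pi * \<theta> 0)"
        by (simp add: cis_divide right_diff_distrib) (simp flip: cis_divide)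
      ultimately show ?thesis using z(1) unfolding F_def by (simp add: sgn_divide sgn_of_real)
    qed
    have z00: "z0 \<noteq> 0" "sgn z0 = z0" using z0(1) by (auto simp: sgn_eq)
    obtain \<theta>0 where \<theta>0: "angle_lift T (P z0) \<theta>0" using ex z00 by blast
    define \<delta> where "\<delta> = \<theta>0 T - \<theta>0 0 - 1"
    have "\<theta>0 T - \<theta>0 0 \<in> ?W" by (rule mem[OF z00(1) \<theta>0])
    then have \<delta>: "0 < \<delta>" "\<delta> < 1" using False gt unfolding \<delta>_def by force+
    have "F z0 \<noteq> 1"
    proof
      assume "F z0 = 1"
      then have "cis (2 * pi * \<delta>) = 1" using F[OF z00(1) \<theta>0] z00 by (simp add: \<delta>_def)
      then have "cos (2 * pi * \<delta>) = 1" by (metis cis.sel(1) one_complex.sel(1))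
      then obtain k :: int where "2 * pi * \<delta> = of_int k * 2 * pi" using cos_one_2pi_int by auto
      then have "\<delta> = of_int k" by simp
      then show False using \<delta> by simp
    qed
    \<comment> \<open>The distance from \<open>F z0\<close> to 1 is the minimal chord, and the arc
      \<open>2 * pi * (d - 1)\<close> is at least as long as its chord.\<close>
    define \<epsilon> where "\<epsilon> = cmod (F z0 - 1) / (2 * pi)"
    show ?thesis
    proof (rule hwz_index_ge_3[OF ne close])
      show "0 < \<epsilon>" using \<open>F z0 \<noteq> 1\<close> by (simp add: \<epsilon>_def)
      fix d assume d: "d \<in> ?W"
      then obtain z \<theta> where z: "z \<noteq> 0" "angle_lift T (P z) \<theta>" "d = \<theta> T - \<theta> 0" by auto
      have "sgn z \<in> sphere 0 1" using z(1) by (simp add: norm_sgn)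
      then have "cmod (F z0 - 1) \<le> cmod (cis (2 * pi * (d - 1)) - 1)"
        using z0(2) F[OF z(1,2)] z(3) by fastforce
      also have "\<dots> \<le> 2 * pi * (d - 1)" using cmod_cis_minus_1_le[of "2 * pi * (d - 1)"] gt[OF d] by simp
      finally show "1 + \<epsilon> \<le> d" by (simp add: \<epsilon>_def field_simps)
    qed simp_all
  qed
qed

subsection \<open>Sums of two potential wells\<close>

text \<open>Conservation of the Wronskian, applied both to a velocity paired with a variation and to
  two variations of the full system.\<close>

lemma wronskian_const:
  fixes q p q' p' k :: "real \<Rightarrow> real"
  assumes "\<And>t. (q has_real_derivative 4 * p t) (at t)" "\<And>t. (p has_real_derivative - k t * q t) (at t)"
    and "\<And>t. (q' has_real_derivative 4 * p' t) (at t)" "\<And>t. (p' has_real_derivative - k t * q' t) (at t)"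
  shows "p t * q' t - q t * p' t = p 0 * q' 0 - q 0 * p' 0"
proof -
  have "((\<lambda>t. p t * q' t - q t * p' t) has_real_derivative 0) (at t)" for t
    by (rule derivative_eq_intros assms refl)+ (simp add: algebra_simps)
  then show ?thesis using DERIV_isconst_all[of "\<lambda>t. p t * q' t - q t * p' t"] by blast
qed

lemma differentiable_path_continuous_on:
  fixes f :: "real \<Rightarrow> real"
  assumes "\<And>t. (f has_real_derivative f' t) (at t)"
  shows "continuous_on S f"
  by (rule DERIV_continuous_on) (rule has_field_derivative_at_within, rule assms)

lemma Complex_path_derivative:
  assumes "(f has_real_derivative f') (at t)" "(g has_real_derivative g') (at t)"
  shows "((\<lambda>t. Complex (f t) (g t)) has_vector_derivative Complex f' g') (at t)"
  unfolding Complex_eq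
  by (rule derivative_eq_intros has_vector_derivative_of_real
      has_real_derivative_iff_has_vector_derivative[THEN iffD1] assms refl)+ simp

text \<open>A \<open>T\<close>-periodic orbit of \<open>2 p\<^sup>2 + V q\<close> in a potential well with bottom \<open>q0\<close>;
  \<open>W\<close> and \<open>k\<close> are \<open>V'\<close> and \<open>V''\<close> along the orbit.\<close>

locale well_orbit =
  fixes T q0 :: real and q p W k :: "real \<Rightarrow> real"
  assumes T: "0 < T"
    and dq: "\<And>t. (q has_real_derivative 4 * p t) (at t)"
    and dp: "\<And>t. (p has_real_derivative - W t) (at t)"
    and dW: "\<And>t. (W has_real_derivative k t * (4 * p t)) (at t)"
    and k_cont: "continuous_on UNIV k"
    and per: "q T = q 0" "p T = p 0" "W T = W 0"
    and W_sign: "\<And>t. q t \<noteq> q0 \<Longrightarrow> (q t - q0) * W t > 0"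
    and W_bottom: "\<And>t. q t = q0 \<Longrightarrow> W t = 0"
    and k_bottom: "\<And>t. q t = q0 \<Longrightarrow> k t > 0"
begin

text \<open>The velocity in the coordinate \<open>p + i q\<close>, where motion around the bottom of
  the well is counterclockwise.\<close>

definition vel :: "real \<Rightarrow> complex" where "vel t = Complex (- W t) (4 * p t)"

lemma vel_cont: "continuous_on S vel"
proof -
  have "continuous_on S W" "continuous_on S p"
    by (rule differentiable_path_continuous_on[OF dW] differentiable_path_continuous_on[OF dp])+
  then show ?thesis unfolding vel_def[abs_def] Complex_eq by (intro continuous_intros)
qed

lemma vel_eq_0_iff: "vel t = 0 \<longleftrightarrow> q t = q0 \<and> p t = 0"
  using W_sign[of t] W_bottom[of t] by (cases "q t = q0") (auto simp: vel_def complex_eq_iff)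

text \<open>The position relative to the bottom rotates positively and closes up, hence makes at
  least one full turn. The velocity always points to the left of the position, so its displacement
  differs by less than 1/2; being a positive integer, it is at least 1.\<close>

lemma vel_winding:
  assumes "\<And>t. vel t \<noteq> 0" "angle_lift T vel \<alpha>"
  shows "\<alpha> T - \<alpha> 0 \<ge> 1"
proof -
  define \<rho> where "\<rho> t = Complex (p t) (q t - q0)" for t
  have \<rho>0: "\<rho> t \<noteq> 0" for t
    using assms(1)[of t] vel_eq_0_iff by (auto simp: \<rho>_def complex_eq_iff)
  have d\<rho>: "(\<rho> has_vector_derivative vel t) (at t)" for t
    unfolding \<rho>_def[abs_def] vel_def using DERIV_diff[OF dq[of t] DERIV_const[of q0]]
    by (intro Complex_path_derivative dp) simp
  have pos: "Im (cnj (\<rho> t) * vel t) > 0" for t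
  proof -
    have "Im (cnj (\<rho> t) * vel t) = 4 * (p t)\<^sup>2 + (q t - q0) * W t"
      by (simp add: \<rho>_def vel_def power2_eq_square algebra_simps)
    moreover have "(q t - q0) * W t > 0 \<or> q t = q0 \<and> p t \<noteq> 0"
      using W_sign[of t] assms(1)[of t] vel_eq_0_iff by blast
    ultimately show ?thesis by (auto simp del: times_complex.sel intro: add_nonneg_pos)
  qed
  have "continuous_on {0..T} \<rho>"
    by (intro continuous_at_imp_continuous_on ballI has_vector_derivative_continuous[OF d\<rho>])
  then obtain \<beta> where \<beta>: "angle_lift T \<rho> \<beta>" using angle_lift_exists \<rho>0 by blast
  have "\<beta> T - \<beta> 0 > 0"
    by (rule angle_lift_increases[OF T \<beta> \<rho>0 has_vector_derivative_at_within[OF d\<rho>] vel_cont pos])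
  moreover from this have "\<beta> T - \<beta> 0 \<ge> 1"
    using angle_lift_loop[OF _ \<beta>] T per \<rho>0 by (force simp: \<rho>_def elim!: Ints_cases)
  moreover have "\<alpha> T - \<alpha> 0 \<in> \<int>"
    using angle_lift_loop[OF _ assms(2)] T per assms(1)[of 0] by (simp add: vel_def)
  moreover have "\<bar>(\<alpha> T - \<alpha> 0) - (\<beta> T - \<beta> 0)\<bar> < 1 / 2"
    by (rule angle_lift_close[OF _ \<beta> assms(2) \<rho>0 assms(1), of 1])
       (use T pos in \<open>simp_all only: sgn_pos less_imp_le\<close>)
  ultimately have "\<alpha> T - \<alpha> 0 > 0" "\<alpha> T - \<alpha> 0 \<in> \<int>" by linarith+
  then show ?thesis by (auto elim!: Ints_cases)
qed

text \<open>At rest the coefficient \<open>k\<close> is positive, so the variation obeys an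
  oscillator equation whose angular velocity has the sign of \<open>4 P^2 + k Q^2\<close>.\<close>

lemma variation_winding:
  assumes rest: "\<And>t. vel t = 0"
    and dQ: "\<And>t. (Q has_real_derivative 4 * P t) (at t)" "\<And>t. (P has_real_derivative - k t * Q t) (at t)"
    and nz: "\<And>t. t \<in> {0..T} \<Longrightarrow> Complex (P t) (Q t) \<noteq> 0"
    and lift: "angle_lift T (\<lambda>t. Complex (P t) (Q t)) \<alpha>"
  shows "\<alpha> T - \<alpha> 0 > 0"
proof (rule angle_lift_increases[OF T lift nz])
  show "((\<lambda>t. Complex (P t) (Q t)) has_vector_derivative Complex (- k t * Q t) (4 * P t)) (at t within {0..T})" for t
    by (rule has_vector_derivative_at_within[OF Complex_path_derivative[OF dQ(2) dQ(1)]])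
  have "continuous_on {0..T} Q" "continuous_on {0..T} P"
    by (rule differentiable_path_continuous_on[OF dQ(1)] differentiable_path_continuous_on[OF dQ(2)])+
  then show "continuous_on {0..T} (\<lambda>t. Complex (- k t * Q t) (4 * P t))"
    unfolding Complex_eq using continuous_on_subset[OF k_cont] by (intro continuous_intros) auto
  show "0 < Im (cnj (Complex (P t) (Q t)) * Complex (- k t * Q t) (4 * P t))" if "t \<in> {0..T}" for t
  proof -
    have "k t > 0" using k_bottom rest vel_eq_0_iff by blast
    then have "0 \<le> 4 * (P t)\<^sup>2" "0 \<le> k t * (Q t)\<^sup>2" "P t \<noteq> 0 \<Longrightarrow> 0 < 4 * (P t)\<^sup>2" "Q t \<noteq> 0 \<Longrightarrow> 0 < k t * (Q t)\<^sup>2"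
      by simp_all
    moreover have "P t \<noteq> 0 \<or> Q t \<noteq> 0" using nz[OF that] by (auto simp: complex_eq_iff)
    ultimately have "0 < 4 * (P t)\<^sup>2 + k t * (Q t)\<^sup>2" by linarith
    then show ?thesis by (simp add: power2_eq_square algebra_simps)
  qed
qed simp_all

text \<open>The velocity itself solves the linearized equation, so its Wronskian with any variation
  is conserved.\<close>

lemma vel_variation_const:
  assumes "\<And>t. (Q has_real_derivative 4 * P t) (at t)" "\<And>t. (P has_real_derivative - k t * Q t) (at t)"
  shows "Im (cnj (vel t) * Complex (P t) (Q t)) = Im (cnj (vel 0) * Complex (P 0) (Q 0))"
proof -
  have d: "((\<lambda>t. 4 * p t) has_real_derivative 4 * (- W t)) (at t)"
    "((\<lambda>t. - W t) has_real_derivative - k t * (4 * p t)) (at t)" for t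
    using DERIV_cmult[OF dp[of t], of 4] DERIV_minus[OF dW[of t]] by simp_all
  show ?thesis
    using wronskian_const[of "\<lambda>t. 4 * p t" "\<lambda>t. - W t" k Q P t, OF d assms] by (simp add: vel_def)
qed

text \<open>The energy of the factor is conserved, and the velocity vanishes exactly when this
  energy has its minimal value \<open>v0\<close>.\<close>

lemma vel_dichotomy:
  assumes dU: "\<And>t. (U has_real_derivative W t * (4 * p t)) (at t)"
    and U: "\<And>t. q t \<noteq> q0 \<Longrightarrow> U t > v0" "\<And>t. q t = q0 \<Longrightarrow> U t = v0"
  shows "(\<forall>t. vel t = 0) \<or> (\<forall>t. vel t \<noteq> 0)"
proof -
  have "((\<lambda>t. 2 * (p t)\<^sup>2 + U t) has_real_derivative 0) (at t)" for t
    by (rule derivative_eq_intros dU dp refl)+ (simp add: algebra_simps)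
  then have E: "2 * (p t)\<^sup>2 + U t = 2 * (p s)\<^sup>2 + U s" for s t
    using DERIV_isconst_all[of "\<lambda>t. 2 * (p t)\<^sup>2 + U t"] by blast
  have "vel t = 0 \<longleftrightarrow> 2 * (p t)\<^sup>2 + U t = v0" for t
  proof (cases "q t = q0")
    case True
    then show ?thesis using U(2)[of t] by (simp add: vel_eq_0_iff)
  next
    case False
    then have "2 * (p t)\<^sup>2 + U t > v0" using U(1)[of t] by (simp add: add_nonneg_pos add_strict_increasing2)
    then show ?thesis using False by (simp add: vel_eq_0_iff)
  qed
  then show ?thesis using E by metis
qed

end

text \<open>On an invariant torus the winding is compared with that of the variation moving only the
  first factor, for which the determinant is minus the product of the velocities.
  If one factor rests at its bottom, the determinant is the product of the velocity of the other
  factor with the (positively rotating) variation of the resting one.\<close>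

lemma det_winding_gt_1:
  assumes A: "well_orbit T a0 qa pa Wa ka" and B: "well_orbit T b0 qb pb Wb kb"
  defines "u \<equiv> well_orbit.vel pa Wa" and "v \<equiv> well_orbit.vel pb Wb"
  assumes dichA: "(\<forall>t. u t = 0) \<or> (\<forall>t. u t \<noteq> 0)" and dichB: "(\<forall>t. v t = 0) \<or> (\<forall>t. v t \<noteq> 0)"
    and varA: "\<And>t. (Qa has_real_derivative 4 * Pa t) (at t)" "\<And>t. (Pa has_real_derivative - ka t * Qa t) (at t)"
    and varB: "\<And>t. (Qb has_real_derivative 4 * Pb t) (at t)" "\<And>t. (Pb has_real_derivative - kb t * Qb t) (at t)"
    and tangent: "Im (cnj (u 0) * Complex (Pa 0) (Qa 0)) + Im (cnj (v 0) * Complex (Pb 0) (Qb 0)) = 0"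
    and D: "\<And>t. D t = u t * Complex (Pb t) (Qb t) - v t * Complex (Pa t) (Qa t)"
    and nz: "\<And>t. t \<in> {0..T} \<Longrightarrow> D t \<noteq> 0"
    and lift: "angle_lift T D \<delta>"
  shows "\<delta> T - \<delta> 0 > 1"
proof -
  interpret A: well_orbit T a0 qa pa Wa ka by (rule A)
  interpret B: well_orbit T b0 qb pb Wb kb by (rule B)
  have T: "0 < T" by (rule A.T)
  define a where "a t = Complex (Pa t) (Qa t)" for t
  define b where "b t = Complex (Pb t) (Qb t)" for t
  have ca: "continuous_on {0..T} a"
  proof -
    have "continuous_on {0..T} Qa" "continuous_on {0..T} Pa"
      by (rule differentiable_path_continuous_on[OF varA(1)] differentiable_path_continuous_on[OF varA(2)])+
    then show ?thesis unfolding a_def[abs_def] Complex_eq by (intro continuous_intros)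
  qed
  have cb: "continuous_on {0..T} b"
  proof -
    have "continuous_on {0..T} Qb" "continuous_on {0..T} Pb"
      by (rule differentiable_path_continuous_on[OF varB(1)] differentiable_path_continuous_on[OF varB(2)])+
    then show ?thesis unfolding b_def[abs_def] Complex_eq by (intro continuous_intros)
  qed
  have Dab: "D t = u t * b t - v t * a t" for t by (simp add: D a_def b_def)
  have cu: "continuous_on {0..T} u" and cv: "continuous_on {0..T} v"
    using A.vel_cont B.vel_cont by (simp_all add: u_def v_def)
  \<comment> \<open>The sign contributes a constant half turn and no displacement.\<close>
  have lift_neg: "angle_lift T (\<lambda>t. - (f t * g t)) (\<lambda>t. \<phi> t + \<psi> t + 1/2)"
    if "angle_lift T f \<phi>" "angle_lift T g \<psi>" for f g \<phi> \<psi>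
  proof -
    have "angle_lift T (\<lambda>_. -1) (\<lambda>_. 1/2)" by (simp add: angle_lift_def)
    from angle_lift_mult[OF angle_lift_mult[OF that] this] show ?thesis by simp
  qed
  have not_both: "\<not> ((\<forall>t. u t = 0) \<and> (\<forall>t. v t = 0))" using nz[of 0] T Dab[of 0] by auto
  consider (torus) "\<forall>t. u t \<noteq> 0" "\<forall>t. v t \<noteq> 0" | (restA) "\<forall>t. u t = 0" "\<forall>t. v t \<noteq> 0"
    | (restB) "\<forall>t. u t \<noteq> 0" "\<forall>t. v t = 0"
    using dichA dichB not_both by blast
  then show ?thesis
  proof cases
    case torus
    obtain \<alpha> \<beta> where \<alpha>: "angle_lift T u \<alpha>" and \<beta>: "angle_lift T v \<beta>"
      using angle_lift_exists[OF cu] angle_lift_exists[OF cv] torus by metis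
    have "\<alpha> T - \<alpha> 0 \<ge> 1" "\<beta> T - \<beta> 0 \<ge> 1"
      using A.vel_winding[of \<alpha>] B.vel_winding[of \<beta>] torus \<alpha> \<beta> by (auto simp: u_def v_def)
    \<comment> \<open>The reference path \<open>- u v\<close> makes at least two turns, so a
      deviation below half a turn leaves more than 3/2.\<close>
    moreover have "\<bar>(\<delta> T - \<delta> 0) - ((\<alpha> T + \<beta> T + 1/2) - (\<alpha> 0 + \<beta> 0 + 1/2))\<bar> < 1/2"
    proof (rule angle_lift_close[OF _ lift_neg[OF \<alpha> \<beta>] lift _ nz])
      fix t
      \<comment> \<open>\<open>h\<close> is conserved, and tangency to the energy level makes the
        corresponding invariant of the second factor \<open>- h\<close>; the two terms below
        therefore add up with one sign.\<close>
      define h where "h = Im (cnj (u 0) * a 0)"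
      have ha: "Im (cnj (u t) * a t) = h"
        using A.vel_variation_const[OF varA, of t] by (simp add: h_def a_def u_def)
      have hb: "Im (cnj (v t) * b t) = - h"
        using B.vel_variation_const[OF varB, of t] tangent by (simp add: h_def a_def b_def u_def v_def)
      have "Im (cnj (- (u t * v t)) * D t) =
          (cmod (v t))\<^sup>2 * Im (cnj (u t) * a t) - (cmod (u t))\<^sup>2 * Im (cnj (v t) * b t)"
        unfolding Dab cmod_power2 by (simp add: power2_eq_square algebra_simps)
      also have "\<dots> = ((cmod (v t))\<^sup>2 + (cmod (u t))\<^sup>2) * h"
        unfolding ha hb by (simp add: algebra_simps)
      finally have *: "Im (cnj (- (u t * v t)) * D t) = ((cmod (v t))\<^sup>2 + (cmod (u t))\<^sup>2) * h" .
      have "(cmod (v t))\<^sup>2 + (cmod (u t))\<^sup>2 > 0" using torus by (simp add: add_pos_pos)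
      then show "sgn (Im (cnj (- (u t * v t)) * D t)) = sgn h"
        unfolding * by (simp only: sgn_mult) simp
    qed (use T torus in auto)
    ultimately show ?thesis by linarith
  next
    case restA
    have an: "a t \<noteq> 0" if "t \<in> {0..T}" for t using nz[OF that] Dab[of t] restA by auto
    obtain \<alpha> \<beta> where \<alpha>: "angle_lift T a \<alpha>" and \<beta>: "angle_lift T v \<beta>"
      using angle_lift_exists[OF ca an] angle_lift_exists[OF cv] restA by metis
    have "\<beta> T - \<beta> 0 \<ge> 1" using B.vel_winding[of \<beta>] restA \<beta> by (auto simp: v_def)
    moreover have "\<alpha> T - \<alpha> 0 > 0"
      using A.variation_winding[OF _ varA, of \<alpha>] restA an \<alpha> by (simp add: u_def a_def[abs_def])
    moreover have "D = (\<lambda>t. - (v t * a t))" using restA by (simp add: Dab fun_eq_iff)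
    then have "angle_lift T D (\<lambda>t. \<beta> t + \<alpha> t + 1/2)"
      using lift_neg[OF \<beta> \<alpha>] by simp
    from angle_lift_unique[OF _ this lift nz]
    have "\<delta> T - \<delta> 0 = (\<beta> T + \<alpha> T + 1/2) - (\<beta> 0 + \<alpha> 0 + 1/2)" using T by simp
    ultimately show ?thesis by linarith
  next
    case restB
    have bn: "b t \<noteq> 0" if "t \<in> {0..T}" for t using nz[OF that] Dab[of t] restB by auto
    obtain \<alpha> \<beta> where \<alpha>: "angle_lift T b \<alpha>" and \<beta>: "angle_lift T u \<beta>"
      using angle_lift_exists[OF cb bn] angle_lift_exists[OF cu] restB by metis
    have "\<beta> T - \<beta> 0 \<ge> 1" using A.vel_winding[of \<beta>] restB \<beta> by (auto simp: u_def)
    moreover have "\<alpha> T - \<alpha> 0 > 0"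
      using B.variation_winding[OF _ varB, of \<alpha>] restB bn \<alpha> by (simp add: v_def b_def[abs_def])
    moreover have "D = (\<lambda>t. u t * b t)" using restB by (simp add: Dab fun_eq_iff)
    then have "angle_lift T D (\<lambda>t. \<beta> t + \<alpha> t)"
      using angle_lift_mult[OF \<beta> \<alpha>] by simp
    from angle_lift_unique[OF _ this lift nz]
    have "\<delta> T - \<delta> 0 = (\<beta> T + \<alpha> T) - (\<beta> 0 + \<alpha> 0)" using T by simp
    ultimately show ?thesis by linarith
  qed
qed

subsection \<open>The linear symplectic geometry and the Hamiltonian\<close>

text \<open>In the coordinates \<open>p + i q\<close> the symplectic form is the imaginary part of the Hermitian
  product and the transverse plane at a point is the complex line orthogonal to the Hamiltonian
  vector \<open>X\<close>. The complex determinant \<open>cdet X w\<close> is thus, up to a positive factor, the coordinate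
  of \<open>w\<close> modulo \<open>X\<close> in a globally defined frame.\<close>

definition cplx1 :: "ph \<Rightarrow> complex" where "cplx1 v = Complex (fst (snd v)) (fst (fst v))"
definition cplx2 :: "ph \<Rightarrow> complex" where "cplx2 v = Complex (snd (snd v)) (snd (fst v))"
definition herm :: "ph \<Rightarrow> ph \<Rightarrow> complex" where
  "herm u v = cnj (cplx1 u) * cplx1 v + cnj (cplx2 u) * cplx2 v"
definition cdet :: "ph \<Rightarrow> ph \<Rightarrow> complex" where
  "cdet u v = cplx1 u * cplx2 v - cplx2 u * cplx1 v"

lemma symp_eq_Im_herm: "symp u v = Im (herm u v)"
  by (cases u; cases v) (auto simp: symp_def herm_def cplx1_def cplx2_def inner_prod_def)

lemma inner_eq_Re_herm: "u \<bullet> v = Re (herm u v)"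
  by (cases u; cases v) (auto simp: herm_def cplx1_def cplx2_def inner_prod_def)

lemma herm_commute: "herm v u = cnj (herm u v)"
  by (simp add: herm_def mult.commute)

lemma herm_self: "herm v v = of_real (v \<bullet> v)"
  by (cases v) (auto simp: herm_def cplx1_def cplx2_def inner_prod_def complex_eq_iff)

lemma lagrange_identity:
  "cnj (cdet x v) * cdet x w = herm x x * herm v w - herm v x * herm x w"
  by (simp add: herm_def cdet_def algebra_simps)

text \<open>Hermitian orthogonality removes the second term of the Lagrange identity. This form
  pairs a frame vector with an arbitrary vector.\<close>

lemma Im_cdet_transverse:
  assumes "herm x v = 0"
  shows "Im (cnj (cdet x v) * cdet x w) = (x \<bullet> x) * symp v w"
proof -
  have "herm v x = 0" using assms herm_commute[of v x] by simp
  then show ?thesis unfolding lagrange_identity herm_self symp_eq_Im_herm by simp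
qed

text \<open>For tangent vectors the Hermitian products with \<open>x\<close> are real, so the second
  term of the Lagrange identity has no imaginary part. This form pairs two variations.\<close>

lemma Im_cdet_tangent:
  assumes "symp x v = 0" "symp x w = 0"
  shows "Im (cnj (cdet x v) * cdet x w) = (x \<bullet> x) * symp v w"
  using assms unfolding lagrange_identity herm_self symp_eq_Im_herm herm_commute[of v x] by simp

lemma symp_linear:
  "symp (u + v) w = symp u w + symp v w" "symp w (u + v) = symp w u + symp w v"
  "symp (r *\<^sub>R u) w = r * symp u w" "symp w (r *\<^sub>R u) = r * symp w u"
  by (simp_all add: symp_def inner_add algebra_simps)

lemma symp_skew: "symp v w = - symp w v"
  by (simp add: symp_def inner_commute)

lemma symp_self: "symp v v = 0"
  by (simp add: symp_def inner_commute)

lemma symp_nondegenerate: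
  assumes "\<And>w. symp X w = symp Y w"
  shows "X = Y"
proof -
  define Z where "Z = X - Y"
  have "symp Z w = 0" for w
    using assms[of w] symp_linear(1)[of Z Y w] by (simp add: Z_def)
  \<comment> \<open>This test vector is \<open>Z\<close> turned by the complex structure, which
    makes the form equal to the squared norm of \<open>Z\<close>.\<close>
  from this[of "(snd Z, - fst Z)"] have "snd Z \<bullet> snd Z + fst Z \<bullet> fst Z = 0"
    by (simp add: symp_def)
  then have "snd Z = 0" "fst Z = 0"
    by (metis add_nonneg_eq_0_iff inner_eq_zero_iff inner_ge_zero)+
  then have "Z = 0" by (simp add: prod_eq_iff)
  then show ?thesis by (simp add: Z_def)
qed

section \<open>The separated potentials and the Hamiltonian vector field\<close>

definition Vl :: "real \<Rightarrow> real \<Rightarrow> real" where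
  "Vl c l = - 2 * cosh l - c * (cosh l)\<^sup>2"
definition Vn :: "real \<Rightarrow> real \<Rightarrow> real \<Rightarrow> real" where
  "Vn \<mu> c n = 2 * (1 - 2 * \<mu>) * cos n + c * (cos n)\<^sup>2"
definition dVl :: "real \<Rightarrow> real \<Rightarrow> real" where
  "dVl c l = - 2 * sinh l - 2 * c * cosh l * sinh l"
definition ddVl :: "real \<Rightarrow> real \<Rightarrow> real" where
  "ddVl c l = - 2 * cosh l - 2 * c * ((cosh l)\<^sup>2 + (sinh l)\<^sup>2)"
definition dVn :: "real \<Rightarrow> real \<Rightarrow> real \<Rightarrow> real" where
  "dVn \<mu> c n = - 2 * (1 - 2 * \<mu>) * sin n - 2 * c * cos n * sin n"
definition ddVn :: "real \<Rightarrow> real \<Rightarrow> real \<Rightarrow> real" where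
  "ddVn \<mu> c n = - 2 * (1 - 2 * \<mu>) * cos n - 2 * c * ((cos n)\<^sup>2 - (sin n)\<^sup>2)"

definition XK :: "real \<Rightarrow> real \<Rightarrow> ph \<Rightarrow> ph" where
  "XK \<mu> c z = ((4 * fst (snd z), 4 * snd (snd z)), (- dVl c (fst (fst z)), - dVn \<mu> c (snd (fst z))))"

definition DXK :: "real \<Rightarrow> real \<Rightarrow> ph \<Rightarrow> ph \<Rightarrow> ph" where
  "DXK \<mu> c z w = ((4 * fst (snd w), 4 * snd (snd w)),
     (- ddVl c (fst (fst z)) * fst (fst w), - ddVn \<mu> c (snd (fst z)) * snd (fst w)))"

lemma dVl_factor: "dVl c l = 2 * (sinh l * (- c * cosh l - 1))"
  by (simp add: dVl_def algebra_simps)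

lemma dVn_factor: "dVn \<mu> c n = 2 * (sin n * (- c * cos n - (1 - 2 * \<mu>)))"
  by (simp add: dVn_def algebra_simps)

lemma Vl_deriv: "(Vl c has_real_derivative dVl c l) (at l)"
  unfolding Vl_def[abs_def] dVl_def
  by (rule derivative_eq_intros refl)+ (simp add: power2_eq_square algebra_simps)

lemma Vn_deriv: "(Vn \<mu> c has_real_derivative dVn \<mu> c n) (at n)"
  unfolding Vn_def[abs_def] dVn_def
  by (rule derivative_eq_intros refl)+ (simp add: power2_eq_square algebra_simps)

lemma dVl_deriv: "(dVl c has_real_derivative ddVl c l) (at l)"
  unfolding dVl_def[abs_def] ddVl_def
  by (rule derivative_eq_intros refl)+ (simp add: power2_eq_square algebra_simps)

lemma dVn_deriv: "(dVn \<mu> c has_real_derivative ddVn \<mu> c n) (at n)"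
  unfolding dVn_def[abs_def] ddVn_def
  by (rule derivative_eq_intros refl)+ (simp add: power2_eq_square algebra_simps)

lemma Kc_eq:
  "Kc \<mu> c z = 2 * (fst (snd z))\<^sup>2 + 2 * (snd (snd z))\<^sup>2 + Vl c (fst (fst z)) + Vn \<mu> c (snd (fst z))"
  by (simp add: Kc_def Vl_def Vn_def case_prod_unfold)

lemma has_derivative_fst_fst: "((\<lambda>z::ph. fst (fst z)) has_derivative (\<lambda>w. fst (fst w))) (at z)"
  and has_derivative_snd_fst: "((\<lambda>z::ph. snd (fst z)) has_derivative (\<lambda>w. snd (fst w))) (at z)"
  by (rule derivative_eq_intros refl)+

lemma Kc_has_derivative: "(Kc \<mu> c has_derivative (\<lambda>w. - symp (XK \<mu> c z) w)) (at z)"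
proof -
  note l = DERIV_compose_FDERIV[OF Vl_deriv has_derivative_fst_fst]
    and n = DERIV_compose_FDERIV[OF Vn_deriv has_derivative_snd_fst]
  have "((\<lambda>z. 2 * (fst (snd z))\<^sup>2 + 2 * (snd (snd z))\<^sup>2 + Vl c (fst (fst z)) + Vn \<mu> c (snd (fst z)))
      has_derivative (\<lambda>w. - symp (XK \<mu> c z) w)) (at z)"
    by (rule l n derivative_eq_intros refl)+
      (auto simp: symp_def XK_def inner_prod_def fun_eq_iff algebra_simps)
  then show ?thesis by (simp only: Kc_eq[abs_def])
qed

lemma frechet_derivative_Kc: "frechet_derivative (Kc \<mu> c) (at z) = (\<lambda>w. - symp (XK \<mu> c z) w)"
  using frechet_derivative_at[OF Kc_has_derivative] by simp

lemma ham_vf_Kc: "ham_vf (Kc \<mu> c) = XK \<mu> c"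
proof
  fix z
  show "ham_vf (Kc \<mu> c) z = XK \<mu> c z"
    unfolding ham_vf_def frechet_derivative_Kc
    by (rule the_equality) (auto intro: symp_nondegenerate)
qed

lemma XK_has_derivative: "(XK \<mu> c has_derivative DXK \<mu> c z) (at z)"
proof -
  note l = DERIV_compose_FDERIV[OF dVl_deriv has_derivative_fst_fst]
    and n = DERIV_compose_FDERIV[OF dVn_deriv has_derivative_snd_fst]
  show ?thesis
    unfolding XK_def[abs_def] DXK_def[abs_def]
    by (rule l n derivative_eq_intros refl)+ (simp add: fun_eq_iff)
qed

lemma frechet_derivative_XK: "frechet_derivative (XK \<mu> c) (at z) = DXK \<mu> c z"
  using frechet_derivative_at[OF XK_has_derivative] by simp

section \<open>Energy levels below the critical value\<close>

lemma cJ_bounds: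
  assumes "0 < \<mu>" "\<mu> \<le> 1 / 2" "c < cJ \<mu>"
  shows "c < -1" "c\<^sup>2 + 2 * c + (1 - 2 * \<mu>)\<^sup>2 > 0"
proof -
  have s: "0 \<le> \<mu> * (1 - \<mu>)" using assms by simp
  then have "0 \<le> sqrt (\<mu> * (1 - \<mu>))" by simp
  then show "c < -1" using assms(3) unfolding cJ_def by linarith
  \<comment> \<open>Squaring gives
    \<open>(c + 1)^2 > 4 \<mu> (1 - \<mu>) = 1 - (1 - 2 \<mu>)^2\<close>.\<close>
  have "2 * sqrt (\<mu> * (1 - \<mu>)) < - c - 1" using assms(3) by (simp add: cJ_def)
  then have "(2 * sqrt (\<mu> * (1 - \<mu>)))\<^sup>2 < (- c - 1)\<^sup>2"
    using \<open>0 \<le> sqrt _\<close> by (intro power_strict_mono) auto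
  then show "c\<^sup>2 + 2 * c + (1 - 2 * \<mu>)\<^sup>2 > 0"
    using s by (simp add: power_mult_distrib) (simp add: power2_eq_square algebra_simps)
qed

text \<open>Below the critical energy no orbit reaches the maxima of the \<open>\<nu>\<close>-potential.\<close>

lemma level_avoids_saddle:
  assumes "0 < \<mu>" "\<mu> \<le> 1 / 2" "c < cJ \<mu>" "Kc \<mu> c z = 0"
  shows "- c * cos (snd (fst z)) \<noteq> 1 - 2 * \<mu>"
proof
  assume *: "- c * cos (snd (fst z)) = 1 - 2 * \<mu>"
  note c = cJ_bounds[OF assms(1-3)]
  define C where "C = cosh (fst (fst z))"
  define y where "y = cos (snd (fst z))"
  have C: "C \<ge> 1" by (simp add: C_def cosh_real_ge_1)
  \<comment> \<open>After multiplication by \<open>- c > 0\<close>, the angular potential at its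
    maximum contributes exactly \<open>(1 - 2 \<mu>)^2\<close>.\<close>
  have "0 = - c * Kc \<mu> c z" using assms(4) by simp
  also have "\<dots> = 2 * (- c) * ((fst (snd z))\<^sup>2 + (snd (snd z))\<^sup>2) + (2 * c * C + c\<^sup>2 * C\<^sup>2) + (1 - 2 * \<mu>)\<^sup>2"
  proof -
    have m: "1 - 2 * \<mu> = - c * y" using * by (simp add: y_def)
    show ?thesis unfolding Kc_eq Vl_def Vn_def m C_def[symmetric] y_def[symmetric]
      by (simp add: power2_eq_square algebra_simps)
  qed
  also have "\<dots> \<ge> (2 * c * C + c\<^sup>2 * C\<^sup>2) + (1 - 2 * \<mu>)\<^sup>2"
    using c by (simp add: mult_nonpos_nonneg)
  finally have "(2 * c * C + c\<^sup>2 * C\<^sup>2) + (1 - 2 * \<mu>)\<^sup>2 \<le> 0" .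
  \<comment> \<open>Expansion around the smallest value \<open>C = 1\<close>, where the total is
    positive by \<open>cJ_bounds\<close>; the remainder is nonnegative.\<close>
  moreover have "2 * c * C + c\<^sup>2 * C\<^sup>2 = c\<^sup>2 + 2 * c + (- c) * (C - 1) * (- c * (C + 1) - 2)"
    by (simp add: power2_eq_square algebra_simps)
  moreover have "- c * (C + 1) \<ge> 1 * 2" using c C by (intro mult_mono) auto
  then have "(- c) * (C - 1) * (- c * (C + 1) - 2) \<ge> 0"
    using c C by (intro mult_nonneg_nonneg) auto
  ultimately show False using c by linarith
qed

text \<open>At an equilibrium the momenta, \<open>sinh\<close> \<lambda> and, away from the maxima,
  \<open>sin\<close> \<nu> vanish. The level equation then reads
  \<open>(1 - 2 \<mu>) cos \<nu> = 1\<close>, which is impossible.\<close>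

lemma XK_neq_0:
  assumes "0 < \<mu>" "\<mu> \<le> 1 / 2" "c < cJ \<mu>" "Kc \<mu> c z = 0"
  shows "XK \<mu> c z \<noteq> 0"
proof
  note c = cJ_bounds[OF assms(1-3)]
  assume "XK \<mu> c z = 0"
  then have p: "fst (snd z) = 0" "snd (snd z) = 0"
    and l: "dVl c (fst (fst z)) = 0" and n: "dVn \<mu> c (snd (fst z)) = 0"
    by (auto simp: XK_def zero_prod_def)
  have "sinh (fst (fst z)) * (- c * cosh (fst (fst z)) - 1) = 0"
    using l unfolding dVl_factor by simp
  moreover have "- c * cosh (fst (fst z)) > 1"
    using mult_mono[of "-c" "-c" 1 "cosh (fst (fst z))"] c cosh_real_ge_1[of "fst (fst z)"] by linarith
  ultimately have l0: "fst (fst z) = 0" by simp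
  have "sin (snd (fst z)) * (- c * cos (snd (fst z)) - (1 - 2 * \<mu>)) = 0"
    using n unfolding dVn_factor by simp
  then have "sin (snd (fst z)) = 0" using level_avoids_saddle[OF assms] by simp
  then have y2: "(cos (snd (fst z)))\<^sup>2 = 1"
    using sin_cos_squared_add[of "snd (fst z)"] by simp
  with assms(4) have "2 * (1 - 2 * \<mu>) * cos (snd (fst z)) = 2"
    by (simp add: Kc_eq Vl_def Vn_def p l0)
  moreover have "cos (snd (fst z)) = 1 \<or> cos (snd (fst z)) = -1"
    using y2 by (simp add: power2_eq_1_iff)
  ultimately show False using assms(1,2) by auto
qed

subsection \<open>Periodic orbits of the Euler problem\<close>

lemma nonvanishing_constant_sign:
  fixes h :: "real \<Rightarrow> real"
  assumes "continuous_on UNIV h" "\<And>t. h t \<noteq> 0"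
  shows "(\<forall>t. h t > 0) \<or> (\<forall>t. h t < 0)"
proof (rule ccontr)
  assume "\<not> ?thesis"
  then obtain s t where "h s \<le> 0" "0 \<le> h t" by (meson not_less)
  moreover have "connected (range h)" by (rule connected_continuous_image[OF assms(1)]) simp
  ultimately have "0 \<in> range h" by (meson connected_contains_Icc atLeastAtMost_iff rangeI subsetD)
  then show False using assms(2) by (metis rangeE)
qed

text \<open>The cosine stays on one side of \<open>m\<close>. At distance pi from the center
  \<open>q0\<close> it would equal \<open>- cos q0\<close>, on the wrong side, so the angle cannot
  leave that interval. The center is the nearest even or odd multiple of pi, according to the
  side.\<close>

lemma angle_confined:
  fixes n :: "real \<Rightarrow> real"
  assumes cont: "continuous_on UNIV n" and m: "-1 < m" "m < 1" and ne: "\<And>t. cos (n t) \<noteq> m"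
  obtains q0 where "sin q0 = 0" "\<And>t. \<bar>n t - q0\<bar> < pi"
    "(cos q0 = 1 \<and> (\<forall>t. cos (n t) > m)) \<or> (cos q0 = -1 \<and> (\<forall>t. cos (n t) < m))"
proof -
  have confine: "\<bar>n t - q0\<bar> < pi" if "\<bar>n 0 - q0\<bar> \<le> pi" "\<And>t. \<bar>n t - q0\<bar> \<noteq> pi" for q0 t
  proof -
    have "(\<forall>t. pi - \<bar>n t - q0\<bar> > 0) \<or> (\<forall>t. pi - \<bar>n t - q0\<bar> < 0)"
      using that(2) by (intro nonvanishing_constant_sign continuous_intros cont) (metis eq_iff_diff_eq_0)
    then show ?thesis using that(1) by (metis diff_gt_0_iff_gt diff_less_0_iff_less not_le)
  qed
  have opp: "cos (n t) = - cos q0" if "\<bar>n t - q0\<bar> = pi" for t q0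
  proof -
    have "n t = q0 + pi \<or> n t = q0 - pi" using that by linarith
    then show ?thesis by auto
  qed
  have "(\<forall>t. cos (n t) - m > 0) \<or> (\<forall>t. cos (n t) - m < 0)"
    using ne by (intro nonvanishing_constant_sign continuous_intros cont) auto
  then show thesis
  proof
    assume gt: "\<forall>t. cos (n t) - m > 0"
    define k where "k = round (n 0 / (2 * pi))"
    define q0 where "q0 = 2 * pi * of_int k"
    have c: "cos q0 = 1" "sin q0 = 0" by (simp_all add: q0_def)
    have "\<bar>of_int k - n 0 / (2 * pi)\<bar> \<le> 1 / 2" unfolding k_def by (rule of_int_round_abs_le)
    then have "2 * pi * \<bar>of_int k - n 0 / (2 * pi)\<bar> \<le> 2 * pi * (1 / 2)"
      by (intro mult_left_mono) auto
    moreover have "2 * pi * \<bar>of_int k - n 0 / (2 * pi)\<bar> = \<bar>2 * pi * (of_int k - n 0 / (2 * pi))\<bar>"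
      by (simp add: abs_mult)
    moreover have "2 * pi * (of_int k - n 0 / (2 * pi)) = q0 - n 0"
      by (simp add: q0_def right_diff_distrib)
    ultimately have "\<bar>n 0 - q0\<bar> \<le> pi" by simp
    moreover have "\<bar>n t - q0\<bar> \<noteq> pi" for t using opp[of t q0] c gt m by (metis diff_gt_0_iff_gt less_asym less_trans)
    ultimately show thesis using that[of q0] confine c gt by auto
  next
    assume lt: "\<forall>t. cos (n t) - m < 0"
    define k where "k = \<lfloor>n 0 / (2 * pi)\<rfloor>"
    define q0 where "q0 = 2 * pi * of_int k + pi"
    have c: "cos q0 = -1" "sin q0 = 0" by (simp_all add: q0_def cos_add sin_add)
    have "of_int k \<le> n 0 / (2 * pi)" "n 0 / (2 * pi) \<le> of_int k + 1" unfolding k_def by linarith+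
    then have "2 * pi * of_int k \<le> n 0" "n 0 \<le> 2 * pi * of_int k + 2 * pi"
      by (simp_all add: field_simps)
    then have "\<bar>n 0 - q0\<bar> \<le> pi" unfolding q0_def by linarith
    moreover have "\<bar>n t - q0\<bar> \<noteq> pi" for t using opp[of t q0] c lt m
      by (metis diff_less_0_iff_less less_asym less_trans minus_minus)
    ultimately show thesis using that[of q0] confine c lt by auto
  qed
qed

lemma x_sin_x_pos:
  fixes x :: real
  assumes "\<bar>x\<bar> < pi" "x \<noteq> 0"
  shows "x * sin x > 0"
proof (cases "x > 0")
  case True
  then show ?thesis using assms sin_gt_zero[of x] by simp
next
  case False
  then have "sin (- x) > 0" using assms by (intro sin_gt_zero) auto
  then show ?thesis using False assms(2) by (simp add: mult_neg_neg)
qed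

locale euler_orbit =
  fixes \<mu> c T :: real and x :: "real \<Rightarrow> ph"
  assumes \<mu>: "0 < \<mu>" "\<mu> \<le> 1 / 2" and c: "c < cJ \<mu>"
    and T: "0 < T" and per: "\<And>t. x (t + T) = x t"
    and level: "\<And>t. Kc \<mu> c (x t) = 0"
    and flow: "\<And>t. (x has_vector_derivative XK \<mu> c (x t)) (at t)"
begin

abbreviation "l t \<equiv> fst (fst (x t))"
abbreviation "n t \<equiv> snd (fst (x t))"
abbreviation "pl t \<equiv> fst (snd (x t))"
abbreviation "pn t \<equiv> snd (snd (x t))"

lemma component_derivs:
  assumes "(w has_vector_derivative w') (at t)"
  shows "((\<lambda>t. fst (fst (w t))) has_real_derivative fst (fst w')) (at t)"
    "((\<lambda>t. snd (fst (w t))) has_real_derivative snd (fst w')) (at t)"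
    "((\<lambda>t. fst (snd (w t))) has_real_derivative fst (snd w')) (at t)"
    "((\<lambda>t. snd (snd (w t))) has_real_derivative snd (snd w')) (at t)"
  unfolding has_real_derivative_iff_has_vector_derivative
  by (intro bounded_linear.has_vector_derivative[OF bounded_linear_fst]
      bounded_linear.has_vector_derivative[OF bounded_linear_snd] assms)+

lemma derivs:
  "(l has_real_derivative 4 * pl t) (at t)" "(n has_real_derivative 4 * pn t) (at t)"
  "(pl has_real_derivative - dVl c (l t)) (at t)" "(pn has_real_derivative - dVn \<mu> c (n t)) (at t)"
  using component_derivs[OF flow[of t]] by (simp_all add: XK_def)

lemma c_less: "c < -1" using cJ_bounds[OF \<mu> c] by simp

lemma x_cont: "continuous_on S x"
  by (intro continuous_at_imp_continuous_on ballI has_vector_derivative_continuous[OF flow])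

lemma per_T: "x T = x 0" using per[of 0] by simp

text \<open>Since \<open>- c > 1\<close>, the factor \<open>- c cosh \<lambda> - 1\<close> is
  positive and the force vanishes only at 0.\<close>

lemma l_well: "well_orbit T 0 l pl (\<lambda>t. dVl c (l t)) (\<lambda>t. ddVl c (l t))"
proof
  show "((\<lambda>t. dVl c (l t)) has_real_derivative ddVl c (l t) * (4 * pl t)) (at t)" for t
    by (rule DERIV_chain2[OF dVl_deriv derivs(1)])
  show "continuous_on UNIV (\<lambda>t. ddVl c (l t))"
    unfolding ddVl_def by (intro continuous_intros x_cont)
  show "(l t - 0) * dVl c (l t) > 0" if "l t \<noteq> 0" for t
  proof -
    have "- c * cosh (l t) > 1"
      using mult_mono[of "-c" "-c" 1 "cosh (l t)"] c_less cosh_real_ge_1[of "l t"] by linarith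
    moreover have "l t * sinh (l t) > 0"
      using that by (cases "l t > 0") (auto simp: mult_neg_neg)
    ultimately have "(l t * sinh (l t)) * (2 * (- c * cosh (l t) - 1)) > 0"
      by (smt (verit) mult_pos_pos)
    then show ?thesis unfolding dVl_factor by (simp only: mult_ac diff_0_right)
  qed
qed (use T derivs per_T c_less in \<open>simp_all add: dVl_def ddVl_def\<close>)

lemma l_dichotomy:
  "(\<forall>t. well_orbit.vel pl (\<lambda>t. dVl c (l t)) t = 0) \<or> (\<forall>t. well_orbit.vel pl (\<lambda>t. dVl c (l t)) t \<noteq> 0)"
proof (rule well_orbit.vel_dichotomy[OF l_well])
  show "((\<lambda>t. Vl c (l t)) has_real_derivative dVl c (l t) * (4 * pl t)) (at t)" for t
    by (rule DERIV_chain2[OF Vl_deriv derivs(1)])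
  show "Vl c (l t) > Vl c 0" if "l t \<noteq> 0" for t
  proof -
    have C: "cosh (l t) > 1"
      using that cosh_real_ge_1[of "l t"] cosh_real_one_iff[of "l t"] by linarith
    moreover have "1 * (cosh (l t) + 1) < - c * (cosh (l t) + 1)"
      using C c_less by (intro mult_strict_right_mono) auto
    ultimately have "(cosh (l t) - 1) * (- c * (cosh (l t) + 1) - 2) > 0"
      using C by (intro mult_pos_pos) auto
    then show ?thesis by (simp add: Vl_def power2_eq_square algebra_simps)
  qed
qed simp

text \<open>The angular potential has wells at the even and at the odd multiples of pi, around M and
  E respectively. Avoiding the maxima confines the orbit to one well, so the center
  \<open>q0\<close> depends on the orbit.\<close>

lemma n_well_dichotomy:
  obtains q0 where "well_orbit T q0 n pn (\<lambda>t. dVn \<mu> c (n t)) (\<lambda>t. ddVn \<mu> c (n t))"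
    "(\<forall>t. well_orbit.vel pn (\<lambda>t. dVn \<mu> c (n t)) t = 0) \<or> (\<forall>t. well_orbit.vel pn (\<lambda>t. dVn \<mu> c (n t)) t \<noteq> 0)"
proof -
  define b where "b = - c"
  define m where "m = 1 - 2 * \<mu>"
  have b: "b > 1" using c_less by (simp add: b_def)
  have m: "0 \<le> m" "m < 1" using \<mu> by (simp_all add: m_def)
  have cn: "continuous_on UNIV n" by (intro continuous_intros x_cont)
  have ne: "cos (n t) \<noteq> m / b" for t
    using level_avoids_saddle[OF \<mu> c level[of t]] b by (auto simp: m_def b_def field_simps)
  have mb: "-1 < m / b" "m / b < 1" using b m by (auto simp: field_simps)
  obtain q0 where q0: "sin q0 = 0" "\<And>t. \<bar>n t - q0\<bar> < pi"
    and side: "(cos q0 = 1 \<and> (\<forall>t. cos (n t) > m / b)) \<or> (cos q0 = -1 \<and> (\<forall>t. cos (n t) < m / b))"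
    using angle_confined[OF cn mb ne] by metis
  \<comment> \<open>The factor \<open>cos q0\<close>, equal to 1 or -1, lets one inequality serve
    both kinds of wells.\<close>
  have side': "cos q0 * (b * cos (n t) - m) > 0" for t
    using side b by (auto simp: field_simps)
  have s2: "cos q0 = 1 \<or> cos q0 = -1" using side by auto
  have sin_n: "sin (n t) = cos q0 * sin (n t - q0)" and cos_n: "cos (n t) = cos q0 * cos (n t - q0)" for t
    using sin_add[of "n t - q0" q0] cos_add[of "n t - q0" q0] q0(1) by simp_all
  have W: "well_orbit T q0 n pn (\<lambda>t. dVn \<mu> c (n t)) (\<lambda>t. ddVn \<mu> c (n t))"
  proof
    show "((\<lambda>t. dVn \<mu> c (n t)) has_real_derivative ddVn \<mu> c (n t) * (4 * pn t)) (at t)" for t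
      by (rule DERIV_chain2[OF dVn_deriv derivs(2)])
    show "continuous_on UNIV (\<lambda>t. ddVn \<mu> c (n t))"
      unfolding ddVn_def by (intro continuous_intros x_cont)
    show "(n t - q0) * dVn \<mu> c (n t) > 0" if "n t \<noteq> q0" for t
    proof -
      have "2 * ((n t - q0) * sin (n t - q0)) * (cos q0 * (b * cos (n t) - m)) > 0"
        using mult_pos_pos[OF x_sin_x_pos[OF q0(2)[of t]] side'[of t]] that by (simp add: mult_ac)
      then show ?thesis unfolding dVn_factor sin_n b_def m_def by (simp only: mult_ac)
    qed
    show "ddVn \<mu> c (n t) > 0" if "n t = q0" for t
    proof -
      have "ddVn \<mu> c (n t) = 2 * (b - m * cos q0)"
        using that q0(1) s2 by (auto simp: ddVn_def b_def m_def algebra_simps)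
      also have "\<dots> > 0" using s2 b m by auto
      finally show ?thesis .
    qed
  qed (use T derivs per_T q0 in \<open>simp_all add: dVn_def\<close>)
  moreover have "(\<forall>t. well_orbit.vel pn (\<lambda>t. dVn \<mu> c (n t)) t = 0) \<or> (\<forall>t. well_orbit.vel pn (\<lambda>t. dVn \<mu> c (n t)) t \<noteq> 0)"
  proof (rule well_orbit.vel_dichotomy[OF W])
    show "((\<lambda>t. Vn \<mu> c (n t)) has_real_derivative dVn \<mu> c (n t) * (4 * pn t)) (at t)" for t
      by (rule DERIV_chain2[OF Vn_deriv derivs(2)])
    show "Vn \<mu> c (n t) > Vn \<mu> c q0" if "n t \<noteq> q0" for t
    proof -
      have "cos (n t - q0) \<noteq> 1"
      proof
        assume "cos (n t - q0) = 1"
        then have "sin (n t - q0) = 0" using cos_one_sin_zero by blast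
        then show False using x_sin_x_pos[OF q0(2)[of t]] that by simp
      qed
      then have ny: "cos (n t) \<noteq> cos q0" using cos_n[of t] s2 by auto
      \<comment> \<open>In each well the two factors have the same sign: both negative around
        \<open>cos q0 = 1\<close>, both positive around \<open>cos q0 = -1\<close>.\<close>
      have "Vn \<mu> c (n t) - Vn \<mu> c q0 = (cos (n t) - cos q0) * (2 * m - b * (cos (n t) + cos q0))"
        by (simp add: Vn_def b_def m_def power2_eq_square algebra_simps)
      also have "\<dots> > 0"
        using s2
      proof
        assume q: "cos q0 = 1"
        have "b * cos (n t) > m" using side'[of t] q by simp
        moreover have "cos (n t) < 1" using ny q cos_le_one[of "n t"] by linarith
        ultimately show ?thesis using q b m by (intro mult_neg_neg) (auto simp: distrib_left)
      next
        assume q: "cos q0 = -1"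
        have "b * cos (n t) < m" using side'[of t] q by simp
        moreover have "cos (n t) > -1" using ny q cos_ge_minus_one[of "n t"] by linarith
        ultimately show ?thesis using q b m by (intro mult_pos_pos) (auto simp: right_diff_distrib)
      qed
      finally show ?thesis by simp
    qed
  qed simp
  ultimately show thesis using that by blast
qed

section \<open>Variations along a periodic orbit\<close>

lemma variation_derivs:
  assumes "\<And>t. (w has_vector_derivative DXK \<mu> c (x t) (w t)) (at t)"
  shows "((\<lambda>t. fst (fst (w t))) has_real_derivative 4 * fst (snd (w t))) (at t)"
    "((\<lambda>t. fst (snd (w t))) has_real_derivative - ddVl c (l t) * fst (fst (w t))) (at t)"
    "((\<lambda>t. snd (fst (w t))) has_real_derivative 4 * snd (snd (w t))) (at t)"
    "((\<lambda>t. snd (snd (w t))) has_real_derivative - ddVn \<mu> c (n t) * snd (fst (w t))) (at t)"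
  using component_derivs[OF assms[of t]] by (simp_all add: DXK_def)

text \<open>The form is the sum of the Wronskians of the two factors, each of which is
  conserved.\<close>

lemma symp_variations_const:
  assumes v: "\<And>t. (v has_vector_derivative DXK \<mu> c (x t) (v t)) (at t)"
    and w: "\<And>t. (w has_vector_derivative DXK \<mu> c (x t) (w t)) (at t)"
  shows "symp (v t) (w t) = symp (v 0) (w 0)"
proof -
  have *: "symp (v t) (w t) =
      (fst (snd (v t)) * fst (fst (w t)) - fst (fst (v t)) * fst (snd (w t))) +
      (snd (snd (v t)) * snd (fst (w t)) - snd (fst (v t)) * snd (snd (w t)))" for t
    by (simp add: symp_def inner_prod_def)
  show ?thesis
    using wronskian_const[OF variation_derivs(1,2)[OF v] variation_derivs(1,2)[OF w], of t]
      wronskian_const[OF variation_derivs(3,4)[OF v] variation_derivs(3,4)[OF w], of t]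
    by (simp add: *)
qed

text \<open>Together with \<open>symp_variations_const\<close> this keeps initially tangent
  variations tangent to the energy level.\<close>

lemma XK_variation: "((\<lambda>t. XK \<mu> c (x t)) has_vector_derivative DXK \<mu> c (x t) (XK \<mu> c (x t))) (at t)"
  using vector_derivative_diff_chain_within[of x _ t UNIV "XK \<mu> c" "DXK \<mu> c (x t)"]
    flow[of t] has_derivative_at_withinI[OF XK_has_derivative] by (simp add: o_def)

lemma cdet_variation_winding:
  assumes w: "\<And>t. (w has_vector_derivative DXK \<mu> c (x t) (w t)) (at t)"
    and tangent: "symp (XK \<mu> c (x 0)) (w 0) = 0"
    and nz: "\<And>t. t \<in> {0..T} \<Longrightarrow> cdet (XK \<mu> c (x t)) (w t) \<noteq> 0"
    and lift: "angle_lift T (\<lambda>t. cdet (XK \<mu> c (x t)) (w t)) \<delta>"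
  shows "\<delta> T - \<delta> 0 > 1"
proof -
  obtain q0 where B: "well_orbit T q0 n pn (\<lambda>t. dVn \<mu> c (n t)) (\<lambda>t. ddVn \<mu> c (n t))"
    and dB: "(\<forall>t. well_orbit.vel pn (\<lambda>t. dVn \<mu> c (n t)) t = 0) \<or> (\<forall>t. well_orbit.vel pn (\<lambda>t. dVn \<mu> c (n t)) t \<noteq> 0)"
    by (rule n_well_dichotomy)
  have velA: "well_orbit.vel pl (\<lambda>t. dVl c (l t)) t = cplx1 (XK \<mu> c (x t))" for t
    by (simp add: well_orbit.vel_def[OF l_well] cplx1_def XK_def)
  have velB: "well_orbit.vel pn (\<lambda>t. dVn \<mu> c (n t)) t = cplx2 (XK \<mu> c (x t))" for t
    by (simp add: well_orbit.vel_def[OF B] cplx2_def XK_def)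
  show ?thesis
  proof (rule det_winding_gt_1[OF l_well B l_dichotomy dB variation_derivs(1,2)[OF w] variation_derivs(3,4)[OF w] _ _ nz lift])
    show "Im (cnj (well_orbit.vel pl (\<lambda>t. dVl c (l t)) 0) * Complex (fst (snd (w 0))) (fst (fst (w 0)))) +
        Im (cnj (well_orbit.vel pn (\<lambda>t. dVn \<mu> c (n t)) 0) * Complex (snd (snd (w 0))) (snd (fst (w 0)))) = 0"
      using tangent unfolding velA velB symp_eq_Im_herm herm_def cplx1_def[of "w 0"] cplx2_def[of "w 0"] by simp
    show "cdet (XK \<mu> c (x t)) (w t) =
        well_orbit.vel pl (\<lambda>t. dVl c (l t)) t * Complex (snd (snd (w t))) (snd (fst (w t))) -
        well_orbit.vel pn (\<lambda>t. dVn \<mu> c (n t)) t * Complex (fst (snd (w t))) (fst (fst (w t)))" for t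
      unfolding velA velB cdet_def cplx1_def[of "w t"] cplx2_def[of "w t"] by simp
  qed
qed

end

section \<open>The frame over the disk and the index bound\<close>

lemma continuous_on_cdet [continuous_intros]:
  assumes "continuous_on S f" "continuous_on S g"
  shows "continuous_on S (\<lambda>z. cdet (f z) (g z))"
  unfolding cdet_def cplx1_def cplx2_def Complex_eq using assms by (intro continuous_intros)

lemma continuous_on_XK [continuous_intros]:
  assumes "continuous_on S f"
  shows "continuous_on S (\<lambda>z. XK \<mu> c (f z))"
proof (rule continuous_on_compose2[OF _ assms])
  show "continuous_on UNIV (XK \<mu> c)"
    by (rule has_derivative_continuous_on[OF XK_has_derivative])
qed simp

text \<open>Tangency and Euclidean orthogonality are the imaginary and real parts of a single
  Hermitian equation.\<close>

lemma transv_Kc_herm: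
  assumes "v \<in> transv (Kc \<mu> c) y"
  shows "herm (XK \<mu> c y) v = 0"
  using assms unfolding transv_def frechet_derivative_Kc ham_vf_Kc
  by (auto simp: symp_eq_Im_herm inner_eq_Re_herm herm_commute[of v] complex_eq_iff)

theorem mainTheorem3:
  fixes \<mu> c :: real and z0 :: ph and x :: "real \<Rightarrow> ph" and T :: real
    and \<Phi> :: "real \<Rightarrow> ph \<Rightarrow> ph" and u e1 e2 :: "complex \<Rightarrow> ph"
  assumes "0 < \<mu>" and "\<mu> \<le> 1 / 2" and "c < cJ \<mu>"
    and "Kc \<mu> c z0 = 0"
    and "periodic_orbit (Kc \<mu> c) (connected_component_set {z. Kc \<mu> c z = 0} z0) x T"
    and "linearized_flow (Kc \<mu> c) x \<Phi>"
    and "spanning_disk (connected_component_set {z. Kc \<mu> c z = 0} z0) x T u"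
    and "symp_frame (Kc \<mu> c) u e1 e2"
  shows "3 \<le> hwz_index (winding_set T \<Phi> e1 e2)"
proof -
  have sub: "connected_component_set {z. Kc \<mu> c z = 0} z0 \<subseteq> {z. Kc \<mu> c z = 0}"
    by (rule connected_component_subset)
  interpret euler_orbit \<mu> c T x
    using assms(1-3,5) sub unfolding periodic_orbit_def ham_vf_Kc by unfold_locales auto
  have \<Phi>0: "\<Phi> 0 v = v" for v using assms(6) unfolding linearized_flow_def by blast
  have \<Phi>: "((\<lambda>s. \<Phi> s v) has_vector_derivative DXK \<mu> c (x t) (\<Phi> t v)) (at t)" for v t
    using assms(6) unfolding linearized_flow_def ham_vf_Kc frechet_derivative_XK by blast
  have u: "continuous_on (cball 0 1) u" "\<And>z. z \<in> cball 0 1 \<Longrightarrow> Kc \<mu> c (u z) = 0"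
    and u_x: "\<And>t. t \<in> {0..T} \<Longrightarrow> u (cis (2 * pi * t / T)) = x t"
    using assms(7) sub unfolding spanning_disk_def by blast+
  have ce: "continuous_on (cball 0 1) e1" "continuous_on (cball 0 1) e2"
    and e: "\<And>z. z \<in> cball 0 1 \<Longrightarrow> herm (XK \<mu> c (u z)) (e1 z) = 0"
      "\<And>z. z \<in> cball 0 1 \<Longrightarrow> herm (XK \<mu> c (u z)) (e2 z) = 0"
      "\<And>z. z \<in> cball 0 1 \<Longrightarrow> symp (e1 z) (e2 z) = 1"
    using assms(8) transv_Kc_herm unfolding symp_frame_def by blast+
  define X where "X z = XK \<mu> c (u z)" for z
  have XX: "X z \<bullet> X z > 0" if "z \<in> cball 0 1" for z
    using XK_neq_0[OF assms(1-3) u(2)[OF that]] by (simp add: X_def)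
  \<comment> \<open>The division cancels the factor \<open>X z \<bullet> X z\<close> of
    \<open>Im_cdet_transverse\<close>, so that pairing with \<open>s1\<close> or \<open>s2\<close>
    gives exactly the symplectic product with the frame vector.\<close>
  define s1 where "s1 z = cdet (X z) (e1 z) / of_real (X z \<bullet> X z)" for z
  define s2 where "s2 z = cdet (X z) (e2 z) / of_real (X z \<bullet> X z)" for z
  have cX: "continuous_on (cball 0 1) X" unfolding X_def by (intro continuous_intros u)
  have cs: "continuous_on (cball 0 1) s1" "continuous_on (cball 0 1) s2"
    unfolding s1_def s2_def using XX by (intro continuous_intros cX ce; force)+
  have Im_s: "Im (cnj (s1 z) * cdet (X z) w) = symp (e1 z) w"
    "Im (cnj (s2 z) * cdet (X z) w) = symp (e2 z) w" if "z \<in> cball 0 1" for z w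
  proof -
    have "cnj (cdet (X z) v / of_real (X z \<bullet> X z)) * cdet (X z) w =
        cnj (cdet (X z) v) * cdet (X z) w / of_real (X z \<bullet> X z)" for v by simp
    then have "Im (cnj (cdet (X z) v / of_real (X z \<bullet> X z)) * cdet (X z) w) = symp v w"
      if "herm (X z) v = 0" for v
      using Im_cdet_transverse[OF that, of w] XX[OF \<open>z \<in> _\<close>] by (simp only: Im_divide_of_real) simp
    then show "Im (cnj (s1 z) * cdet (X z) w) = symp (e1 z) w"
      "Im (cnj (s2 z) * cdet (X z) w) = symp (e2 z) w"
      unfolding s1_def s2_def using e that by (simp_all only: X_def)
  qed
  have Im_s12: "Im (cnj (s1 z) * s2 z) = 1 / (X z \<bullet> X z)" if "z \<in> cball 0 1" for z
  proof -
    have "cnj (s1 z) * s2 z = cnj (s1 z) * cdet (X z) (e2 z) / of_real (X z \<bullet> X z)"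
      by (simp add: s2_def)
    then show ?thesis using Im_s(1)[OF that, of "e2 z"] e(3)[OF that] by (simp only: Im_divide_of_real)
  qed
  have s_pos: "Im (cnj (s1 z) * s2 z) > 0" if "z \<in> cball 0 1" for z
    unfolding Im_s12[OF that] using XX[OF that] by simp
  define v where "v z = Re z *\<^sub>R e1 1 + Im z *\<^sub>R e2 1" for z
  define D where "D z t = cdet (XK \<mu> c (x t)) (\<Phi> t (v z))" for z t
  have circ: "cis r \<in> cball 0 1" for r by simp
  have u1: "u 1 = x 0" using u_x[of 0] T by simp
  \<comment> \<open>The trivialized path thus consists of the frame coordinates of the determinant
    \<open>D\<close>, in the shape required by \<open>angle_lift_gt_1_disk_frame\<close>.\<close>
  have P: "triv_path T \<Phi> e1 e2 z t = Complex (- Im (cnj (s2 (cis (2 * pi * t / T))) * D z t))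
      (Im (cnj (s1 (cis (2 * pi * t / T))) * D z t))" if "t \<in> {0..T}" for z t
  proof -
    have "D z t = cdet (X (cis (2 * pi * t / T))) (\<Phi> t (v z))" by (simp add: D_def X_def u_x[OF that])
    then show ?thesis unfolding triv_path_def Let_def v_def[symmetric]
      using Im_s[OF circ, of "2 * pi * t / T" "\<Phi> t (v z)"] symp_skew[of "\<Phi> t (v z)"] by simp
  qed
  have "symp (XK \<mu> c (x 0)) (e1 1) = 0" "symp (XK \<mu> c (x 0)) (e2 1) = 0"
    using e(1,2)[of 1] u1 by (simp_all add: symp_eq_Im_herm)
  then have tangent0: "symp (XK \<mu> c (x 0)) (v z) = 0" for z
    by (simp add: v_def symp_linear)
  have tangent: "symp (XK \<mu> c (x t)) (\<Phi> t (v z)) = 0" for t z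
    using symp_variations_const[OF XK_variation \<Phi>[of "v z"], of t] tangent0 \<Phi>0 by simp
  have symp_v: "symp (v z) (v w) = Im (cnj z * w)" for z w
    using e(3)[of 1] symp_skew[of "e2 1" "e1 1"]
    by (simp add: v_def symp_linear symp_self algebra_simps)
  have cD: "continuous_on {0..T} (D z)" for z
  proof -
    have "continuous_on {0..T} (\<lambda>t. \<Phi> t (v z))"
      by (intro continuous_at_imp_continuous_on ballI has_vector_derivative_continuous[OF \<Phi>])
    then show ?thesis unfolding D_def by (intro continuous_intros x_cont)
  qed
  have area: "Im (cnj (triv_path T \<Phi> e1 e2 z t) * triv_path T \<Phi> e1 e2 w t) = Im (cnj z * w)"
    if t: "t \<in> {0..T}" for z w t
  proof -
    have Xt: "X (cis (2 * pi * t / T)) = XK \<mu> c (x t)" by (simp add: X_def u_x[OF t])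
    \<comment> \<open>The determinant scales areas by the squared norm of the vector field, and the
      frame coordinates scale them by its inverse.\<close>
    have "Im (cnj (D z t) * D w t) = (XK \<mu> c (x t) \<bullet> XK \<mu> c (x t)) * Im (cnj z * w)"
      unfolding D_def Im_cdet_tangent[OF tangent tangent]
      using symp_variations_const[OF \<Phi>[of "v z"] \<Phi>[of "v w"], of t] \<Phi>0 symp_v by simp
    then show ?thesis
      unfolding P[OF t] positive_frame_area Im_s12[OF circ] Xt
      using XX[OF circ, of "2 * pi * t / T"] Xt by simp
  qed
  have D_nz: "D z t \<noteq> 0" if "z \<noteq> 0" "t \<in> {0..T}" for z t
  proof
    assume "D z t = 0"
    then have "Im (cnj z * (\<i> * z)) = 0" using area[OF that(2), of z "\<i> * z"] P[OF that(2), of z] by (simp add: Complex_eq)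
    then have "(Re z)\<^sup>2 + (Im z)\<^sup>2 = 0" by (simp add: power2_eq_square)
    then show False using that(1) by (simp add: complex_eq_iff)
  qed
  have "3 \<le> hwz_index {d. \<exists>z. z \<noteq> 0 \<and> (\<exists>\<theta>. angle_lift T (triv_path T \<Phi> e1 e2 z) \<theta> \<and> d = \<theta> T - \<theta> 0)}"
  proof (rule hwz_index_area_preserving_path[OF T _ _ area])
    show "triv_path T \<Phi> e1 e2 z 0 = z" for z
      using e(3)[of 1] symp_skew[of "e2 1" "e1 1"]
      by (simp add: triv_path_def \<Phi>0 symp_linear symp_self)
    show "continuous_on {0..T} (triv_path T \<Phi> e1 e2 z)" for z
    proof -
      have "continuous_on {0..T} (\<lambda>t. cis (2 * pi * t / T))"
        using T by (intro continuous_intros) auto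
      then have "continuous_on {0..T} (\<lambda>t. s1 (cis (2 * pi * t / T)))"
        "continuous_on {0..T} (\<lambda>t. s2 (cis (2 * pi * t / T)))"
        by (intro continuous_on_compose2[OF cs(1)] continuous_on_compose2[OF cs(2)]; auto)+
      then have "continuous_on {0..T} (\<lambda>t. Complex (- Im (cnj (s2 (cis (2 * pi * t / T))) * D z t))
          (Im (cnj (s1 (cis (2 * pi * t / T))) * D z t)))"
        unfolding Complex_eq by (intro continuous_intros cD)
      then show ?thesis by (rule continuous_on_eq) (simp add: P)
    qed
    fix z \<theta> assume z: "z \<noteq> 0" and \<theta>: "angle_lift T (triv_path T \<Phi> e1 e2 z) \<theta>"
    obtain \<delta> where \<delta>: "angle_lift T (D z) \<delta>" using angle_lift_exists[OF cD D_nz[OF z]] by blast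
    have gt: "\<delta> T - \<delta> 0 > 1"
      using cdet_variation_winding[OF \<Phi>[of "v z"], of \<delta>] tangent0 D_nz[OF z] \<delta> \<Phi>0
      unfolding D_def[abs_def] by simp
    show "\<theta> T - \<theta> 0 > 1"
      by (rule angle_lift_gt_1_disk_frame[OF T cs s_pos cD D_nz[OF z] \<delta> gt P \<theta>])
  qed
  also have "{d. \<exists>z. z \<noteq> 0 \<and> (\<exists>\<theta>. angle_lift T (triv_path T \<Phi> e1 e2 z) \<theta> \<and> d = \<theta> T - \<theta> 0)} =
      winding_set T \<Phi> e1 e2"
    unfolding winding_set_def angle_lift_def conj_assoc ..
  finally show ?thesis .
qed

end
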